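(* Let $\rho_{AB}$ be a density operator on $\mathcal{H}_A\otimes\mathcal{H}_B$ (finite-dimensional). Let $\alpha>0$ and $\beta,\gamma\geq 1/2$ (all different from $1$) satisfy $$\frac{\alpha}{\alpha-1}=\frac{\beta}{\beta-1}+\frac{\gamma}{\gamma-1}.$$ If $(\alpha-1)(\beta-1)(\gamma-1)>0$, then $$I^\uparrow_\gamma(A;B)_\rho\geq H_\beta(B)_\rho-H^\downarrow_\alpha(B|A)_\rho\quad\text{and}\quad I^\downarrow_\gamma(A:B)_\rho\geq H_\beta(B)_\rho-H^\uparrow_\alpha(B|A)_\rho .$$ If instead $(\alpha-1)(\beta-1)(\gamma-1)<0$, then $$I^\uparrow_\gamma(A;B)_\rho\leq H_\beta(B)_\rho-H^\downarrow_\alpha(B|A)_\rho\quad\text{and}\quad I^\downarrow_\gamma(A:B)_\rho\leq H_\beta(B)_\rho-H^\uparrow_\alpha(B|A)_\rho .$$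
   Context: All Hilbert spaces are finite-dimensional, $\log$ is base 2, $\mathrm{id}$ denotes an identity operator, and $\rho_A,\rho_B$ are the marginals of $\rho_{AB}$. $\mathcal{D}(A)$ is the set of density operators on $\mathcal{H}_A$. For positive semidefinite $\rho,\sigma$ and $\alpha\in(0,1)\cup(1,\infty)$ the sandwiched Rényi divergence is $D_\alpha(\rho\|\sigma)=\frac{1}{\alpha-1}\log\mathrm{tr}\big[(\sigma^{\frac{1-\alpha}{2\alpha}}\rho\,\sigma^{\frac{1-\alpha}{2\alpha}})^\alpha\big]$ if the images of $\rho$ and $\sigma$ do not intersect only in $\{0\}$ and (the kernel of $\sigma$ is contained in the kernel of $\rho$, or $\alpha<1$), and $D_\alpha(\rho\|\sigma)=+\infty$ otherwise. Rényi entropy: $H_\beta(B)_\rho=\frac{1}{1-\beta}\log\mathrm{tr}(\rho_B^\beta)$. Conditional entropies: $H^\downarrow_\alpha(B|A)_\rho=-D_\alpha(\rho_{AB}\|\rho_A\otimes\mathrm{id}_B)$ and $H^\uparrow_\alpha(B|A)_\rho=-\inf_{\sigma_A\in\mathcal{D}(A)}D_\alpha(\rho_{AB}\|\sigma_A\otimes\mathrm{id}_B)$. Mutual informations: $I^\uparrow_\gamma(A;B)_\rho=\inf_{\sigma_B\in\mathcal{D}(B)}D_\gamma(\rho_{AB}\|\rho_A\otimes\sigma_B)$ and $I^\downarrow_\gamma(A:B)_\rho=\inf_{\sigma_A\in\mathcal{D}(A),\sigma_B\in\mathcal{D}(B)}D_\gamma(\rho_{AB}\|\sigma_A\otimes\sigma_B)$.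 *)

theory Defs
  imports Complex_Main "HOL-Library.Extended_Real" "Jordan_Normal_Form.Matrix"
begin

text \<open>Finite-dimensional quantum operators are represented as complex square matrices.
  A bipartite system A B with dimensions dA, dB lives on a space of dimension dA * dB,
  where the basis vector |i> (x) |j> (i < dA, j < dB) has index i * dB + j.\<close>

definition adjoint :: "complex mat \<Rightarrow> complex mat" where
  "adjoint M = mat (dim_col M) (dim_row M) (\<lambda>(i,j). cnj (M $$ (j,i)))"

definition mtrace :: "complex mat \<Rightarrow> complex" where
  "mtrace M = (\<Sum>i<dim_row M. M $$ (i,i))"

definition hermitian :: "complex mat \<Rightarrow> nat \<Rightarrow> bool" where
  "hermitian M n \<longleftrightarrow> M \<in> carrier_mat n n \<and> adjoint M = M"

definition psd :: "complex mat \<Rightarrow> nat \<Rightarrow> bool" where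
  "psd M n \<longleftrightarrow> hermitian M n \<and> (\<forall>v \<in> carrier_vec n. 0 \<le> Re ((M *\<^sub>v v) \<bullet>c v))"

definition density :: "complex mat \<Rightarrow> nat \<Rightarrow> bool" where
  "density M n \<longleftrightarrow> psd M n \<and> mtrace M = 1"

definition unitary :: "complex mat \<Rightarrow> nat \<Rightarrow> bool" where
  "unitary U n \<longleftrightarrow> U \<in> carrier_mat n n \<and> adjoint U * U = 1\<^sub>m n"

text \<open>Real power of a positive semidefinite matrix via its spectral decomposition
  M = U diag(d) U^*, d \<ge> 0.  Powers are taken on the support only
  (0 powr p = 0), i.e. negative powers are generalized inverses; this is the
  standard convention in the definition of the sandwiched Renyi divergence.\<close>
definition mat_power :: "complex mat \<Rightarrow> real \<Rightarrow> complex mat" where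
  "mat_power M p =
     (let n = dim_row M;
          (U, d) = (SOME (U, d). unitary U n \<and> (\<forall>i<n. 0 \<le> d i) \<and>
                      M = U * mat_diag n (\<lambda>i. complex_of_real (d i)) * adjoint U)
      in U * mat_diag n (\<lambda>i. complex_of_real (d i powr p)) * adjoint U)"

definition kron :: "complex mat \<Rightarrow> complex mat \<Rightarrow> complex mat" where
  "kron X Y = mat (dim_row X * dim_row Y) (dim_col X * dim_col Y)
     (\<lambda>(r,c). X $$ (r div dim_row Y, c div dim_col Y) * Y $$ (r mod dim_row Y, c mod dim_col Y))"

definition ptrace_B :: "nat \<Rightarrow> nat \<Rightarrow> complex mat \<Rightarrow> complex mat" where
  "ptrace_B dA dB M = mat dA dA (\<lambda>(i,k). \<Sum>j<dB. M $$ (i * dB + j, k * dB + j))"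

definition ptrace_A :: "nat \<Rightarrow> nat \<Rightarrow> complex mat \<Rightarrow> complex mat" where
  "ptrace_A dA dB M = mat dB dB (\<lambda>(j,l). \<Sum>i<dA. M $$ (i * dB + j, i * dB + l))"

definition mimage :: "complex mat \<Rightarrow> complex vec set" where
  "mimage M = {M *\<^sub>v v | v. v \<in> carrier_vec (dim_col M)}"

definition mkernel :: "complex mat \<Rightarrow> complex vec set" where
  "mkernel M = {v \<in> carrier_vec (dim_col M). M *\<^sub>v v = 0\<^sub>v (dim_row M)}"

definition sandwiched_renyi :: "real \<Rightarrow> complex mat \<Rightarrow> complex mat \<Rightarrow> ereal" where
  "sandwiched_renyi \<alpha> \<rho> \<sigma> =
     (if (\<exists>v \<in> mimage \<rho> \<inter> mimage \<sigma>. v \<noteq> 0\<^sub>v (dim_row \<rho>)) \<and>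
         (mkernel \<sigma> \<subseteq> mkernel \<rho> \<or> \<alpha> < 1)
      then (let s = mat_power \<sigma> ((1 - \<alpha>) / (2 * \<alpha>)) in
            ereal (1 / (\<alpha> - 1) * log 2 (Re (mtrace (mat_power (s * \<rho> * s) \<alpha>)))))
      else \<infinity>)"

definition renyi_entropy_B :: "nat \<Rightarrow> nat \<Rightarrow> real \<Rightarrow> complex mat \<Rightarrow> real" where
  "renyi_entropy_B dA dB \<beta> \<rho> =
     1 / (1 - \<beta>) * log 2 (Re (mtrace (mat_power (ptrace_A dA dB \<rho>) \<beta>)))"

definition cond_entropy_down :: "nat \<Rightarrow> nat \<Rightarrow> real \<Rightarrow> complex mat \<Rightarrow> ereal" where
  "cond_entropy_down dA dB \<alpha> \<rho> =
     - sandwiched_renyi \<alpha> \<rho> (kron (ptrace_B dA dB \<rho>) (1\<^sub>m dB))"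

definition cond_entropy_up :: "nat \<Rightarrow> nat \<Rightarrow> real \<Rightarrow> complex mat \<Rightarrow> ereal" where
  "cond_entropy_up dA dB \<alpha> \<rho> =
     - (INF \<sigma>\<in>{\<sigma>. density \<sigma> dA}. sandwiched_renyi \<alpha> \<rho> (kron \<sigma> (1\<^sub>m dB)))"

definition mutual_info_up :: "nat \<Rightarrow> nat \<Rightarrow> real \<Rightarrow> complex mat \<Rightarrow> ereal" where
  "mutual_info_up dA dB \<gamma> \<rho> =
     (INF \<sigma>\<in>{\<sigma>. density \<sigma> dB}. sandwiched_renyi \<gamma> \<rho> (kron (ptrace_B dA dB \<rho>) \<sigma>))"

definition mutual_info_down :: "nat \<Rightarrow> nat \<Rightarrow> real \<Rightarrow> complex mat \<Rightarrow> ereal" where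
  "mutual_info_down dA dB \<gamma> \<rho> =
     (INF \<sigma>\<in>{\<sigma>. density \<sigma> dA} \<times> {\<tau>. density \<tau> dB}.
        sandwiched_renyi \<gamma> \<rho> (kron (fst \<sigma>) (snd \<sigma>)))"

end

theory Submission
  imports Defs "Jordan_Normal_Form.Schur_Decomposition" "Jordan_Normal_Form.Spectral_Radius"
begin

text \<open>Write $x' = (x-1)/x$, so that the hypothesis reads $1/\alpha' = 1/\beta' + 1/\gamma'$, and let
  $\rho = C C^*$, $\tau_A$ and $\sigma_B$ be fixed. Since $K K^*$ and $K^* K$ have the same nonzero
  spectrum, each divergence is a power trace of $M = C^* X C$ with $X$ a power of $\tau \otimes \sigma$,
  and $\frac{1}{x'} \log$ of $\sum_k \langle g_k, M g_k \rangle p_k^{x'}$, over orthonormal bases $g$ and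
  probability weights $p$, is maximised by $\frac{1}{x-1} \log \mathrm{tr} M^x$. The eigenvectors of
  $\tau$, $\sigma$ and the basis $g$ live on three different tensor factors (of a purification), so all
  three quantities are sums over one common nonnegative array $w$ weighted by monomials in the
  eigenvalues. The three exponent vectors are collinear exactly by the hypothesis on
  $\alpha, \beta, \gamma$, and the claim for fixed $\tau, \sigma$ is the scalar Hoelder inequality. In the
  positive case it holds for every $\sigma$; in the negative case $\sigma$ is taken to be the optimiser
  $\rho_B^\beta / \mathrm{tr} \rho_B^\beta$ of the entropy term.\<close>

subsection \<open>Adjoints, unitaries and the spectral theorem\<close>

text \<open>The sandwiched matrix lives on the same space as \<open>\<tau>\<close> and
  \<open>\<sigma>\<close> and need not commute with them; moving the outer power to the input side
  of \<open>C\<close> frees its test basis from the two reference eigenbases, so every diagonal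
  entry is linear in squared moduli. Each variational formula bounds its quantity from below by a
  trial value. The terms on the smaller side of the claim must therefore sit at their optimum, while
  those on the larger side accept any trial data; this decides when \<open>\<sigma>\<close> may be
  arbitrary and when it must be optimal. The estimate holds for each \<open>\<tau>\<close>, so
  infima enter only at the end. The remaining obstacle is zero eigenvalues: with
  \<open>0 powr p = 0\<close> also for negative \<open>p\<close>, the pointwise Hoelder bound can
  fail at zeros. The finiteness guards of the divergences are therefore translated into vanishing
  rows of \<open>V^* C\<close>, a form independent of the test basis, and carried along with the
  estimates.\<close>

lemma adjoint_carrier [simp]: "M \<in> carrier_mat n m \<Longrightarrow> adjoint M \<in> carrier_mat m n"
  by (auto simp: adjoint_def)

lemma adjoint_dim [simp]: "dim_row (adjoint M) = dim_col M" "dim_col (adjoint M) = dim_row M"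
  by (auto simp: adjoint_def)

lemma adjoint_index [simp]:
  "i < dim_col M \<Longrightarrow> j < dim_row M \<Longrightarrow> adjoint M $$ (i,j) = cnj (M $$ (j,i))"
  by (simp add: adjoint_def)

lemma adjoint_adjoint [simp]: "adjoint (adjoint M) = M"
  by (rule eq_matI) auto

lemma adjoint_mult:
  "dim_col A = dim_row B \<Longrightarrow> adjoint (A * B) = adjoint B * adjoint A"
  by (rule eq_matI) (auto simp: scalar_prod_def mult.commute intro!: sum.cong)

lemma adjoint_mat_diag_real [simp]:
  "adjoint (mat_diag n (\<lambda>i. complex_of_real (d i))) = mat_diag n (\<lambda>i. complex_of_real (d i))"
  by (rule eq_matI) (auto simp: mat_diag_def)

lemma mult_index_sum:
  assumes "A \<in> carrier_mat n m" "B \<in> carrier_mat m l" "i < n" "j < l"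
  shows "(A * B) $$ (i,j) = (\<Sum>k<m. A $$ (i,k) * B $$ (k,j))"
  using assms by (auto simp: scalar_prod_def atLeast0LessThan)

lemma adjoint_mult_index:
  assumes "A \<in> carrier_mat m n" "B \<in> carrier_mat m l" "i < n" "j < l"
  shows "(adjoint A * B) $$ (i,j) = (\<Sum>k<m. cnj (A $$ (k,i)) * B $$ (k,j))"
  using assms by (subst mult_index_sum[of _ n m _ l]) (auto intro!: sum.cong)

lemma mult_adjoint_index:
  assumes "A \<in> carrier_mat n m" "B \<in> carrier_mat l m" "i < n" "j < l"
  shows "(A * adjoint B) $$ (i,j) = (\<Sum>k<m. A $$ (i,k) * cnj (B $$ (j,k)))"
  using assms by (subst mult_index_sum[of _ n m _ l]) (auto intro!: sum.cong)

lemma unitaryD: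
  assumes "unitary U n"
  shows "U \<in> carrier_mat n n" "adjoint U * U = 1\<^sub>m n" "U * adjoint U = 1\<^sub>m n"
proof -
  show *: "U \<in> carrier_mat n n" "adjoint U * U = 1\<^sub>m n"
    using assms by (auto simp: unitary_def)
  then show "U * adjoint U = 1\<^sub>m n"
    using mat_mult_left_right_inverse[of "adjoint U" n U] by auto
qed

lemma unitary_cancel:
  assumes "unitary U n" "A \<in> carrier_mat n m" 
  shows "adjoint U * (U * A) = A" "U * (adjoint U * A) = A"
proof -
  note U = unitaryD[OF assms(1)]
  show "adjoint U * (U * A) = A" "U * (adjoint U * A) = A"
    using U assms(2) by (simp_all add: assoc_mult_mat[of _ n n _ n _ m, symmetric])
qed

lemma unitary_cancel_vec:
  assumes "unitary U n" "v \<in> carrier_vec n"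
  shows "adjoint U *\<^sub>v (U *\<^sub>v v) = v" "U *\<^sub>v (adjoint U *\<^sub>v v) = v"
proof -
  note U = unitaryD[OF assms(1)]
  show "adjoint U *\<^sub>v (U *\<^sub>v v) = v" "U *\<^sub>v (adjoint U *\<^sub>v v) = v"
    using U assms(2) by (simp_all add: assoc_mult_mat_vec[of _ n n _ n, symmetric])
qed

lemma unitary_one: "unitary (1\<^sub>m n) n"
proof -
  have "adjoint (1\<^sub>m n) = 1\<^sub>m n" by (rule eq_matI) auto
  then show ?thesis by (simp add: unitary_def)
qed

lemma unitary_mult:
  assumes "unitary U n" "unitary V n" shows "unitary (U * V) n"
proof -
  note U = unitaryD[OF assms(1)] and V = unitaryD[OF assms(2)]
  have "adjoint (U * V) * (U * V) = adjoint V * (adjoint U * (U * V))"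
    using U V by (subst adjoint_mult) (auto simp: assoc_mult_mat[of _ n n _ n _ n])
  also have "\<dots> = 1\<^sub>m n" using V by (simp add: unitary_cancel[OF assms(1), of _ n])
  finally show ?thesis using U V by (auto simp: unitary_def)
qed

lemma unitary_adjoint: "unitary U n \<Longrightarrow> unitary (adjoint U) n"
  by (frule unitaryD(1), frule unitaryD(3)) (simp add: unitary_def)

lemma unitary_col_norm:
  assumes "unitary U n" "j < n"
  shows "(\<Sum>i<n. (cmod (U $$ (i,j)))\<^sup>2) = 1"
proof -
  note U = unitaryD[OF assms(1)]
  have "(adjoint U * U) $$ (j,j) = (\<Sum>i<n. cnj (U $$ (i,j)) * U $$ (i,j))"
    using U assms by (intro adjoint_mult_index) auto
  also have "\<dots> = complex_of_real (\<Sum>i<n. (cmod (U $$ (i,j)))\<^sup>2)"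
    unfolding of_real_sum by (intro sum.cong) (simp_all add: mult.commute[of "cnj _"] complex_norm_square del: of_real_power)
  finally have "complex_of_real (\<Sum>i<n. (cmod (U $$ (i,j)))\<^sup>2) = 1" using U assms by simp
  then show ?thesis using of_real_eq_1_iff by blast
qed

lemma unitary_row_norm:
  assumes "unitary U n" "i < n"
  shows "(\<Sum>j<n. (cmod (U $$ (i,j)))\<^sup>2) = 1"
proof -
  have "(\<Sum>j<n. (cmod (U $$ (i,j)))\<^sup>2) = (\<Sum>j<n. (cmod (adjoint U $$ (j,i)))\<^sup>2)"
    using unitaryD(1)[OF assms(1)] assms(2) by (intro sum.cong) auto
  then show ?thesis using unitary_col_norm[OF unitary_adjoint[OF assms(1)] assms(2)] by simp
qed

lemma hermitian_conj:
  assumes "hermitian M n" "A \<in> carrier_mat n m"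
  shows "hermitian (adjoint A * M * A) m"
  using assms by (auto simp: hermitian_def adjoint_mult assoc_mult_mat[of _ m n _ n _ m])

lemma conj_diag_entry:
  assumes "M \<in> carrier_mat n n" "A \<in> carrier_mat n m" "k < m"
  shows "(adjoint A * M * A) $$ (k,k) = (M *\<^sub>v col A k) \<bullet>c col A k"
proof -
  have "(adjoint A * M * A) $$ (k,k) = (adjoint A * (M * A)) $$ (k,k)"
    using assms by (simp add: assoc_mult_mat[of _ m n _ n _ m])
  also have "\<dots> = (\<Sum>i<n. cnj (A $$ (i,k)) * (M * A) $$ (i,k))"
    using assms by (intro adjoint_mult_index) auto
  also have "\<dots> = (M *\<^sub>v col A k) \<bullet>c col A k"
    using assms by (auto simp: scalar_prod_def atLeast0LessThan mult.commute intro!: sum.cong)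
  finally show ?thesis .
qed

lemma conj_conj:
  assumes "M \<in> carrier_mat n n" "A \<in> carrier_mat n m" "B \<in> carrier_mat m l"
  shows "adjoint B * (adjoint A * M * A) * B = adjoint (A * B) * M * (A * B)"
proof -
  have c: "adjoint A \<in> carrier_mat m n" "adjoint B \<in> carrier_mat l m" using assms by auto
  have "adjoint (A * B) * M * (A * B) = (adjoint B * adjoint A * M) * (A * B)"
    using assms by (simp add: adjoint_mult)
  also have "\<dots> = (adjoint B * adjoint A * M) * A * B"
    using assms c by (intro assoc_mult_mat[symmetric, of _ l n _ m _ l]) auto
  also have "(adjoint B * adjoint A * M) * A = adjoint B * adjoint A * (M * A)"
    using assms c by (intro assoc_mult_mat[of _ l n _ n _ m]) auto
  also have "\<dots> = adjoint B * (adjoint A * (M * A))"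
    using assms c by (intro assoc_mult_mat[of _ l m _ n _ m]) auto
  also have "adjoint A * (M * A) = adjoint A * M * A"
    using assms c by (intro assoc_mult_mat[symmetric, of _ m n _ n _ m]) auto
  finally show ?thesis by simp
qed

lemma psd_conj:
  assumes "psd M n" "A \<in> carrier_mat n m"
  shows "psd (adjoint A * M * A) m"
proof -
  have M: "M \<in> carrier_mat n n" and H: "hermitian M n" 
    using assms by (auto simp: psd_def hermitian_def)
  have "0 \<le> Re ((adjoint A * M * A *\<^sub>v v) \<bullet>c v)" if v: "v \<in> carrier_vec m" for v
  proof -
    define B where "B = mat m 1 (\<lambda>(i,j). v $ i)"
    have B: "B \<in> carrier_mat m 1" "col B 0 = v" using v by (auto simp: B_def)
    have "(adjoint A * M * A *\<^sub>v v) \<bullet>c v = (adjoint B * (adjoint A * M * A) * B) $$ (0,0)"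
      using assms M B by (subst conj_diag_entry[of _ m _ 1]) auto
    also have "adjoint B * (adjoint A * M * A) * B = adjoint (A * B) * M * (A * B)"
      using M assms(2) B(1) by (rule conj_conj)
    also have "\<dots> $$ (0,0) = (M *\<^sub>v col (A * B) 0) \<bullet>c col (A * B) 0"
      using assms M B by (subst conj_diag_entry[of _ n _ 1]) auto
    also have "0 \<le> Re \<dots>"
      using assms B by (auto simp: psd_def)
    finally show ?thesis .
  qed
  then show ?thesis using hermitian_conj[OF H assms(2)] by (auto simp: psd_def)
qed

lemma psd_diag_entry:
  assumes "psd M n" "k < n"
  shows "0 \<le> Re (M $$ (k,k))" "Im (M $$ (k,k)) = 0"
proof -
  have M: "M \<in> carrier_mat n n" and A: "adjoint M = M" using assms by (auto simp: psd_def hermitian_def)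
  have "adjoint (1\<^sub>m n) * M * 1\<^sub>m n = M"
    using M unitaryD[OF unitary_one, of n] by simp
  then have "M $$ (k,k) = (M *\<^sub>v col (1\<^sub>m n) k) \<bullet>c col (1\<^sub>m n) k"
    using conj_diag_entry[OF M, of "1\<^sub>m n" n k] assms by simp
  then show "0 \<le> Re (M $$ (k,k))" using assms by (auto simp: psd_def)
  have "cnj (M $$ (k,k)) = M $$ (k,k)"
    using adjoint_index[of k M k] A M assms by auto
  then show "Im (M $$ (k,k)) = 0" by (simp add: complex_eq_iff)
qed

lemma psd_mult_adjoint:
  assumes "K \<in> carrier_mat n m" shows "psd (K * adjoint K) n"
proof -
  have "hermitian (1\<^sub>m m) m" by (auto simp: hermitian_def intro!: eq_matI)
  moreover have "0 \<le> Re (v \<bullet>c v)" if "v \<in> carrier_vec m" for v :: "complex vec"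
  proof -
    have "v \<bullet>c v = complex_of_real (\<Sum>i<m. (cmod (v $ i))\<^sup>2)"
      using that by (simp add: scalar_prod_def atLeast0LessThan complex_norm_square del: of_real_power)
    then show ?thesis by (simp add: sum_nonneg)
  qed
  ultimately have "psd (1\<^sub>m m) m" by (auto simp: psd_def)
  from psd_conj[OF this, of "adjoint K" n] assms show ?thesis by simp
qed

text \<open>Gram-Schmidt on a basis completion of \<open>v\<close> keeps the first vector, so after
  normalisation column 0 is still a multiple of \<open>v\<close>. This is the base change for the
  deflation step of the spectral theorem.\<close>

lemma unitary_with_first_col:
  assumes v: "v \<in> carrier_vec n" "v \<noteq> 0\<^sub>v n"
  obtains W c where "unitary W n" "c \<noteq> 0" "col W 0 = c \<cdot>\<^sub>v v"
proof -
  interpret cof_vec_space n "TYPE(complex)" .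
  define b where "b = basis_completion v"
  define ws where "ws = gram_schmidt n b"
  note bc = basis_completion[OF v, folded b_def]
  obtain bs where b: "b = v # bs" by (auto simp: b_def basis_completion_def Let_def)
  note gs = gram_schmidt_result[OF bc(2,4,5) ws_def]
  have len: "length ws = n" using gs bc by auto
  have n0: "0 < n" using v by (cases n) auto
  have wc: "ws ! i \<in> carrier_vec n" if "i < n" for i using gs(3) len that by auto
  have hd: "ws ! 0 = v" using gram_schmidt_hd[OF v(1), of bs] b len n0 unfolding ws_def
    by (metis hd_conv_nth length_0_conv less_not_refl2 ws_def)
  have orth: "ws ! i \<bullet>c ws ! j = 0 \<longleftrightarrow> i \<noteq> j" if "i < n" "j < n" for i j
    using corthogonalD[OF gs(2)] that len by auto
  define nrm where "nrm i = sqrt (\<Sum>k<n. (cmod (ws ! i $ k))\<^sup>2)" for i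
  have sq: "ws ! i \<bullet>c ws ! i = complex_of_real ((nrm i)\<^sup>2)" if "i < n" for i
    using wc[OF that] by (auto simp: nrm_def scalar_prod_def atLeast0LessThan sum_nonneg complex_norm_square simp flip: of_real_power intro!: sum.cong)
  have nz: "nrm i \<noteq> 0" if "i < n" for i using sq[OF that] orth[OF that that] by auto
  \<comment> \<open>\<open>gram_schmidt\<close> returns orthogonal but unnormalised vectors, hence
    the division by \<open>nrm j\<close>.\<close>
  define W where "W = mat n n (\<lambda>(i,j). ws ! j $ i / complex_of_real (nrm j))"
  have W: "W \<in> carrier_mat n n" by (simp add: W_def)
  have "adjoint W * W = 1\<^sub>m n"
  proof (rule eq_matI)
    fix i j assume "i < dim_row (1\<^sub>m n)" "j < dim_col (1\<^sub>m n)"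
    then have ij: "i < n" "j < n" by auto
    have "(adjoint W * W) $$ (i,j) = (\<Sum>k<n. ws ! j $ k * cnj (ws ! i $ k)) / (nrm i * nrm j)"
      using ij by (subst adjoint_mult_index[OF W W]) (auto simp: W_def sum_divide_distrib mult.commute)
    also have "(\<Sum>k<n. ws ! j $ k * cnj (ws ! i $ k)) = ws ! j \<bullet>c ws ! i"
      using wc[OF ij(1)] by (auto simp: scalar_prod_def atLeast0LessThan)
    finally show "(adjoint W * W) $$ (i,j) = 1\<^sub>m n $$ (i,j)"
      using orth[OF ij(2,1)] sq[OF ij(1)] nz[OF ij(1)] ij by (auto simp: power2_eq_square)
  qed (use W in auto)
  then have "unitary W n" using W by (simp add: unitary_def)
  moreover have "col W 0 = (1 / complex_of_real (nrm 0)) \<cdot>\<^sub>v v"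
    using n0 v hd by (intro eq_vecI) (auto simp: W_def)
  moreover have "1 / complex_of_real (nrm 0) \<noteq> 0" using nz[OF n0] by simp
  ultimately show thesis using that by blast
qed

text \<open>Deflation: with an eigenvector as first column of \<open>W\<close>, the first column of
  \<open>W^* M W\<close> vanishes below the corner, hermiticity clears the first row too, and the
  remaining block is diagonalised by induction. Eigenvalues stay complex here; for psd matrices
  \<open>psd_spectral\<close> makes them real and nonnegative.\<close>

lemma hermitian_diagonalizable:
  assumes "hermitian M n"
  obtains U d where "unitary U n" "M = U * mat_diag n d * adjoint U"
proof -
  have "\<exists>U d. unitary U n \<and> M = U * mat_diag n d * adjoint U"
    using assms
  proof (induction n arbitrary: M)
    case 0
    then show ?case using unitary_one[of 0]
      by (intro exI[of _ "1\<^sub>m 0"] exI[of _ "\<lambda>_. 0"]) (auto simp: hermitian_def intro!: eq_matI)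
  next
    case (Suc n)
    then have M: "M \<in> carrier_mat (Suc n) (Suc n)" and H: "adjoint M = M"
      by (auto simp: hermitian_def)
    obtain e where "e \<in> spectrum M" using spectrum_non_empty[OF M] by auto
    then obtain v where "eigenvector M v e" by (auto simp: spectrum_def eigenvalue_def)
    then have v: "v \<in> carrier_vec (Suc n)" "v \<noteq> 0\<^sub>v (Suc n)" "M *\<^sub>v v = e \<cdot>\<^sub>v v"
      using M by (auto simp: eigenvector_def)
    obtain W c where W: "unitary W (Suc n)" and c: "c \<noteq> 0" "col W 0 = c \<cdot>\<^sub>v v"
      using unitary_with_first_col[OF v(1,2)] .
    note Wu = unitaryD[OF W]
    define B where "B = adjoint W * M * W"
    have B: "B \<in> carrier_mat (Suc n) (Suc n)" using Wu M by (auto simp: B_def)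
    have hB: "hermitian B (Suc n)" unfolding B_def using Suc.prems Wu by (intro hermitian_conj) auto
    have MW: "M *\<^sub>v col W 0 = e \<cdot>\<^sub>v col W 0"
      unfolding c using v M by (simp add: mult_mat_vec[of _ "Suc n" "Suc n"] smult_smult_assoc mult.commute)
    have col0: "B $$ (i,0) = (if i = 0 then e else 0)" if i: "i < Suc n" for i
    proof -
      have "B = adjoint W * (M * W)" unfolding B_def using Wu M
        by (simp add: assoc_mult_mat[of _ "Suc n" "Suc n" _ "Suc n" _ "Suc n"])
      then have "B $$ (i,0) = (\<Sum>k<Suc n. cnj (W $$ (k,i)) * (M * W) $$ (k,0))"
        using Wu M i by (simp only:) (rule adjoint_mult_index[of _ _ "Suc n" _ "Suc n"], auto)
      also have "\<dots> = (\<Sum>k<Suc n. cnj (W $$ (k,i)) * (e * W $$ (k,0)))"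
      proof (intro sum.cong refl)
        fix k assume "k \<in> {..<Suc n}"
        then have "(M * W) $$ (k,0) = (M *\<^sub>v col W 0) $ k" using M Wu by simp
        also have "\<dots> = e * W $$ (k,0)" using MW Wu \<open>k \<in> _\<close> by simp
        finally show "cnj (W $$ (k,i)) * (M * W) $$ (k,0) = cnj (W $$ (k,i)) * (e * W $$ (k,0))"
          by simp
      qed
      also have "\<dots> = e * (\<Sum>k<Suc n. cnj (W $$ (k,i)) * W $$ (k,0))"
        unfolding sum_distrib_left by (intro sum.cong) auto
      also have "(\<Sum>k<Suc n. cnj (W $$ (k,i)) * W $$ (k,0)) = (adjoint W * W) $$ (i,0)"
        using Wu i by (intro adjoint_mult_index[symmetric]) auto
      finally show ?thesis using Wu i by simp
    qed
    have row0: "B $$ (0,j) = (if j = 0 then e else 0)" if j: "j < Suc n" for j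
    proof -
      have "B $$ (0,j) = cnj (B $$ (j,0))"
        using hB B adjoint_index[of 0 B j] j by (auto simp: hermitian_def)
      \<comment> \<open>The corner entry \<open>e\<close> is real, so mirroring column 0 does not
        conjugate it.\<close>
      moreover have "B $$ (0,0) = cnj (B $$ (0,0))"
        using hB B adjoint_index[of 0 B 0] by (auto simp: hermitian_def)
      ultimately show ?thesis using col0[OF j] col0[of 0] by auto
    qed
    define B' where "B' = mat n n (\<lambda>(i,j). B $$ (Suc i, Suc j))"
    have "hermitian B' n"
    proof -
      have sym: "cnj (B $$ (j,i)) = B $$ (i,j)" if "i < Suc n" "j < Suc n" for i j
      proof -
        have "adjoint B $$ (i,j) = cnj (B $$ (j,i))" using B that by (intro adjoint_index) auto
        then show ?thesis using hB by (simp add: hermitian_def)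
      qed
      have "adjoint B' = B'" by (rule eq_matI) (auto simp: B'_def sym)
      then show ?thesis by (simp add: hermitian_def B'_def)
    qed
    then obtain U' d' where U': "unitary U' n" "B' = U' * mat_diag n d' * adjoint U'"
      using Suc.IH by blast
    note Uu = unitaryD[OF U'(1)]
    \<comment> \<open>The block sum of 1 and \<open>U'\<close>: it leaves the split-off eigenvector
      alone and diagonalises the lower block.\<close>
    define Z where "Z = mat (Suc n) (Suc n) (\<lambda>(i,j). if i = 0 \<or> j = 0 then (if i = j then 1 else 0) else U' $$ (i-1,j-1))"
    define d where "d i = (if i = 0 then e else d' (i-1))" for i
    have Z: "Z \<in> carrier_mat (Suc n) (Suc n)" by (simp add: Z_def)
    have uZ: "unitary Z (Suc n)"
    proof -
      have "adjoint Z * Z = 1\<^sub>m (Suc n)"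
      proof (rule eq_matI)
        fix i j assume "i < dim_row (1\<^sub>m (Suc n))" "j < dim_col (1\<^sub>m (Suc n))"
        then have ij: "i < Suc n" "j < Suc n" by auto
        have "(adjoint Z * Z) $$ (i,j) = (\<Sum>k<Suc n. cnj (Z $$ (k,i)) * Z $$ (k,j))"
          using Z ij by (intro adjoint_mult_index)
        also have "\<dots> = cnj (Z $$ (0,i)) * Z $$ (0,j) + (\<Sum>k<n. cnj (Z $$ (Suc k,i)) * Z $$ (Suc k,j))"
          by (rule sum.lessThan_Suc_shift)
        also have "\<dots> = 1\<^sub>m (Suc n) $$ (i,j)"
        proof (cases "i = 0 \<or> j = 0")
          case True
          then show ?thesis using ij by (auto simp: Z_def)
        next
          case False
          then obtain i' j' where ij': "i = Suc i'" "j = Suc j'" by (metis not0_implies_Suc)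
          have "(\<Sum>k<n. cnj (U' $$ (k,i')) * U' $$ (k,j')) = (adjoint U' * U') $$ (i',j')"
            using Uu ij ij' by (intro adjoint_mult_index[symmetric]) auto
          then show ?thesis using ij ij' Uu by (auto simp: Z_def)
        qed
        finally show "(adjoint Z * Z) $$ (i,j) = 1\<^sub>m (Suc n) $$ (i,j)" .
      qed (use Z in auto)
      then show ?thesis using Z by (simp add: unitary_def)
    qed
    have Bd: "B = Z * mat_diag (Suc n) d * adjoint Z"
    proof (rule eq_matI)
      fix i j assume "i < dim_row (Z * mat_diag (Suc n) d * adjoint Z)" "j < dim_col (Z * mat_diag (Suc n) d * adjoint Z)"
      then have ij: "i < Suc n" "j < Suc n" using Z by auto
      have "(Z * mat_diag (Suc n) d * adjoint Z) $$ (i,j) = (\<Sum>k<Suc n. Z $$ (i,k) * d k * cnj (Z $$ (j,k)))"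
        using Z ij by (subst mult_adjoint_index[of _ "Suc n" "Suc n" _ "Suc n"]) (auto simp: mat_diag_mult_right[OF Z] intro!: sum.cong)
      also have "\<dots> = Z $$ (i,0) * e * cnj (Z $$ (j,0)) + (\<Sum>k<n. Z $$ (i,Suc k) * d' k * cnj (Z $$ (j,Suc k)))"
        by (subst sum.lessThan_Suc_shift) (simp add: d_def)
      also have "\<dots> = B $$ (i,j)"
      proof (cases "i = 0 \<or> j = 0")
        case True
        then show ?thesis using ij row0 col0 by (auto simp: Z_def)
      next
        case False
        then obtain i' j' where ij': "i = Suc i'" "j = Suc j'" by (metis not0_implies_Suc)
        have "(\<Sum>k<n. U' $$ (i',k) * d' k * cnj (U' $$ (j',k))) = B' $$ (i',j')"
          unfolding U'(2) using Uu ij ij' by (subst mult_adjoint_index[of _ n n _ n]) (auto simp: mat_diag_mult_right[OF Uu(1)] intro!: sum.cong)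
        then show ?thesis using ij ij' Uu by (auto simp: Z_def B'_def)
      qed
      finally show "B $$ (i,j) = (Z * mat_diag (Suc n) d * adjoint Z) $$ (i,j)" by simp
    qed (use Z B in auto)
    have "M = W * B * adjoint W"
      unfolding B_def using Wu M
      by (simp add: assoc_mult_mat[of _ "Suc n" "Suc n" _ "Suc n" _ "Suc n"] unitary_cancel[OF W, of _ "Suc n"])
    also have "\<dots> = (W * Z) * mat_diag (Suc n) d * adjoint (W * Z)"
      unfolding Bd using Wu Z
      by (simp add: adjoint_mult assoc_mult_mat[of _ "Suc n" "Suc n" _ "Suc n" _ "Suc n"]
          mult_carrier_mat[of _ "Suc n" "Suc n" _ "Suc n"])
    finally show ?case using unitary_mult[OF W uZ] by blast
  qed
  then show thesis using that by blast
qed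

text \<open>The eigenvalues are the diagonal entries of \<open>U^* M U\<close>, which is again psd,
  and a psd matrix has a real nonnegative diagonal.\<close>

lemma psd_spectral:
  assumes "psd M n"
  obtains U d where "unitary U n" "\<And>i. 0 \<le> d i"
    "M = U * mat_diag n (\<lambda>i. complex_of_real (d i)) * adjoint U"
proof -
  have "hermitian M n" using assms by (auto simp: psd_def)
  then obtain U c where U: "unitary U n" "M = U * mat_diag n c * adjoint U"
    using hermitian_diagonalizable by blast
  note Uu = unitaryD[OF U(1)]
  have "adjoint U * M * U = mat_diag n c"
    unfolding U(2) using Uu by (simp add: assoc_mult_mat[of _ n n _ n _ n] unitary_cancel[OF U(1), of _ n]
        mult_carrier_mat[of _ n n _ n] right_mult_one_mat[of _ n n])
  then have "psd (mat_diag n c) n" using psd_conj[OF assms Uu(1)] by simp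
  from psd_diag_entry[OF this] have c: "0 \<le> Re (c k)" "Im (c k) = 0" if "k < n" for k
    using that by (auto simp: mat_diag_def)
  \<comment> \<open>Extending by 0 beyond \<open>n\<close> gives nonnegativity at every index,
    without a range condition.\<close>
  define d where "d i = (if i < n then Re (c i) else 0)" for i
  have "mat_diag n c = mat_diag n (\<lambda>i. complex_of_real (d i))"
    by (rule eq_matI) (auto simp: mat_diag_def d_def complex_eq_iff c)
  then show thesis using U that[OF U(1), of d] c by (auto simp: d_def)
qed

subsection \<open>Three-point Hoelder inequality\<close>

text \<open>Apply \<open>ln x \<le> x - 1\<close> at \<open>a / c\<close> and \<open>b / c\<close>
  with \<open>c\<close> the weighted arithmetic mean: the linear parts then cancel exactly.\<close>

lemma young_powr:
  fixes a b l :: real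
  assumes "0 \<le> a" "0 \<le> b" "0 < l" "l < 1"
  shows "a powr l * b powr (1 - l) \<le> l * a + (1 - l) * b"
proof (cases "a = 0 \<or> b = 0")
  case True
  then show ?thesis using assms by auto
next
  case False
  define c where "c = l * a + (1 - l) * b"
  have ab: "a > 0" "b > 0" using False assms by auto
  have c: "c > 0" unfolding c_def using ab assms by (intro add_pos_pos mult_pos_pos) auto
  have "l * (ln a - ln c) + (1 - l) * (ln b - ln c) \<le> l * (a / c - 1) + (1 - l) * (b / c - 1)"
    using ab c assms ln_le_minus_one[of "a / c"] ln_le_minus_one[of "b / c"]
    by (intro add_mono mult_left_mono) (auto simp: ln_div)
  also have "\<dots> = (l * a + (1 - l) * b) / c - 1"
    using c by (simp add: field_simps)
  also have "\<dots> = 0" using c by (simp add: c_def)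
  finally have "l * ln a + (1 - l) * ln b \<le> ln c" by (simp add: algebra_simps)
  then have "exp (l * ln a + (1 - l) * ln b) \<le> exp (ln c)" by simp
  then show ?thesis using ab c by (simp add: powr_def exp_add c_def)
qed

text \<open>Normalise the two sums on the right to 1 and apply Young termwise. The pointwise bound
  is asked only where \<open>w i > 0\<close>, because in the applications it can fail at zero
  eigenvalues that carry no weight.\<close>

lemma holder_three_point:
  fixes w x y z :: "'i \<Rightarrow> real"
  assumes fin: "finite I" and l: "0 < l" "l < 1"
    and nn: "\<And>i. i \<in> I \<Longrightarrow> 0 \<le> w i" "\<And>i. i \<in> I \<Longrightarrow> 0 \<le> y i" "\<And>i. i \<in> I \<Longrightarrow> 0 \<le> z i"
    and le: "\<And>i. i \<in> I \<Longrightarrow> 0 < w i \<Longrightarrow> x i \<le> y i powr l * z i powr (1 - l)"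
  shows "(\<Sum>i\<in>I. w i * x i) \<le> (\<Sum>i\<in>I. w i * y i) powr l * (\<Sum>i\<in>I. w i * z i) powr (1 - l)"
proof -
  define Y Z where "Y = (\<Sum>i\<in>I. w i * y i)" and "Z = (\<Sum>i\<in>I. w i * z i)"
  have YZ: "0 \<le> Y" "0 \<le> Z" using nn by (auto simp: Y_def Z_def intro!: sum_nonneg)
  have wx: "w i * x i \<le> w i * (y i powr l * z i powr (1 - l))" if "i \<in> I" for i
    using nn(1)[OF that] le[OF that] by (cases "w i = 0") (auto intro!: mult_left_mono)
  show ?thesis
  proof (cases "Y = 0 \<or> Z = 0")
    case True
    \<comment> \<open>A vanishing sum of nonnegative terms kills one factor of every product
      term.\<close>
    have "w i * (y i powr l * z i powr (1 - l)) = 0" if "i \<in> I" for i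
    proof -
      have "w i * y i = 0 \<or> w i * z i = 0"
        using True that nn fin unfolding Y_def Z_def
        by (subst (asm) (1 2) sum_nonneg_eq_0_iff) auto
      then show ?thesis by auto
    qed
    then have "(\<Sum>i\<in>I. w i * x i) \<le> (\<Sum>i\<in>I. 0)" using wx by (intro sum_mono) force
    then show ?thesis using True by (auto simp: Y_def[symmetric] Z_def[symmetric])
  next
    case False
    then have p: "Y > 0" "Z > 0" using YZ by auto
    have "(\<Sum>i\<in>I. w i * x i) \<le> (\<Sum>i\<in>I. Y powr l * Z powr (1 - l) * (l * (w i * y i / Y) + (1 - l) * (w i * z i / Z)))"
    proof (intro sum_mono)
      fix i assume i: "i \<in> I"
      have "w i * x i \<le> w i * (y i powr l * z i powr (1 - l))" by (rule wx[OF i])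
      also have "y i powr l * z i powr (1 - l) = Y powr l * Z powr (1 - l) * ((y i / Y) powr l * (z i / Z) powr (1 - l))"
        using p nn[OF i] by (simp add: powr_divide)
      also have "w i * \<dots> \<le> w i * (Y powr l * Z powr (1 - l) * (l * (y i / Y) + (1 - l) * (z i / Z)))"
        using young_powr[of "y i / Y" "z i / Z" l] p nn[OF i] l
        by (intro mult_left_mono) auto
      finally show "w i * x i \<le> Y powr l * Z powr (1 - l) * (l * (w i * y i / Y) + (1 - l) * (w i * z i / Z))"
        by (simp add: algebra_simps)
    qed
    also have "\<dots> = Y powr l * Z powr (1 - l) * (l * (Y / Y) + (1 - l) * (Z / Z))"
      by (simp add: sum_distrib_left[symmetric] sum.distrib Y_def Z_def sum_divide_distrib[symmetric])
    also have "\<dots> = Y powr l * Z powr (1 - l)" using p by simp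
    finally show ?thesis by (simp add: Y_def Z_def)
  qed
qed

text \<open>The second weight \<open>m\<close> is a separate parameter because the weights occur as
  ratios such as \<open>a / g\<close> and \<open>a / b\<close>, which sum to 1 only through the
  exponent relation.\<close>

lemma holder_three_point_ln:
  fixes w x y z :: "'i \<Rightarrow> real"
  assumes fin: "finite I" and l: "0 < l" "0 < m" "l + m = 1"
    and nn: "\<And>i. i \<in> I \<Longrightarrow> 0 \<le> w i" "\<And>i. i \<in> I \<Longrightarrow> 0 \<le> y i" "\<And>i. i \<in> I \<Longrightarrow> 0 \<le> z i"
    and le: "\<And>i. i \<in> I \<Longrightarrow> 0 < w i \<Longrightarrow> x i \<le> y i powr l * z i powr m"
    and pos: "0 < (\<Sum>i\<in>I. w i * x i)" "0 < (\<Sum>i\<in>I. w i * y i)" "0 < (\<Sum>i\<in>I. w i * z i)"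
  shows "ln (\<Sum>i\<in>I. w i * x i) \<le> l * ln (\<Sum>i\<in>I. w i * y i) + m * ln (\<Sum>i\<in>I. w i * z i)"
proof -
  have m: "m = 1 - l" "l < 1" using l by auto
  have "(\<Sum>i\<in>I. w i * x i) \<le> (\<Sum>i\<in>I. w i * y i) powr l * (\<Sum>i\<in>I. w i * z i) powr m"
    unfolding m(1) using fin l(1) m(2) nn le[unfolded m(1)] by (rule holder_three_point)
  then have "ln (\<Sum>i\<in>I. w i * x i) \<le> ln ((\<Sum>i\<in>I. w i * y i) powr l * (\<Sum>i\<in>I. w i * z i) powr m)"
    using pos by (subst ln_le_cancel_iff) auto
  then show ?thesis using pos by (simp add: ln_mult ln_powr)
qed

text \<open>The exponent triples $(-a,0,a)$, $(0,b,0)$, $(-g,-g,g)$ of $(T,S,O)$ are collinear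
  precisely because $1/a = 1/b + 1/g$; the signs decide which one lies between the other two.\<close>

lemma collinear_exponents_pos:
  fixes w T S P :: "'i \<Rightarrow> real"
  assumes fin: "finite I" and abg: "a \<noteq> 0" "b \<noteq> 0" "g \<noteq> 0" "1 / a = 1 / b + 1 / g" "a * b * g > 0"
    and nn: "\<And>i. i \<in> I \<Longrightarrow> 0 \<le> w i" "\<And>i. i \<in> I \<Longrightarrow> 0 \<le> T i" "\<And>i. i \<in> I \<Longrightarrow> 0 \<le> S i" "\<And>i. i \<in> I \<Longrightarrow> 0 \<le> P i"
    and sP: "\<And>i. i \<in> I \<Longrightarrow> 0 < w i \<Longrightarrow> 0 < T i \<Longrightarrow> 0 < S i \<Longrightarrow> 0 < P i"
    and sTS: "\<And>i. i \<in> I \<Longrightarrow> 0 < w i \<Longrightarrow> 0 < g \<Longrightarrow> 0 < T i \<and> 0 < S i"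
    and ne: "i0 \<in> I" "0 < w i0" "0 < T i0" "0 < S i0"
  shows "ln (\<Sum>i\<in>I. w i * (T i powr (-a) * P i powr a)) / a
     \<le> ln (\<Sum>i\<in>I. w i * ((T i * S i) powr (-g) * P i powr g)) / g + ln (\<Sum>i\<in>I. w i * S i powr b) / b"
    (is "ln ?G1 / a \<le> ln ?G3 / g + ln ?G2 / b")
proof -
  have P0: "0 < P i0" using sP ne by auto
  have pos: "0 < ?G1" "0 < ?G2" "0 < ?G3"
    using ne P0 nn by (auto intro!: sum_pos2[OF fin ne(1)])
  \<comment> \<open>A positive product allows a fourth pattern, \<open>a > 0\<close>,
    \<open>b < 0\<close>, \<open>g < 0\<close>, which \<open>1 / a = 1 / b + 1 / g\<close> rules
    out. In the other three the middle vector belongs to \<open>?G1\<close>, \<open>?G2\<close> and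
    \<open>?G3\<close> respectively.\<close>
  consider "a > 0" "b > 0" "g > 0" | "a < 0" "b < 0" "g > 0" | "a < 0" "b > 0" "g < 0"
  proof -
    have "\<not> (a > 0 \<and> b < 0 \<and> g < 0)"
    proof
      assume "a > 0 \<and> b < 0 \<and> g < 0"
      then have "1 / a > 0" "1 / b < 0" "1 / g < 0" by auto
      then show False using abg(4) by linarith
    qed
    then show thesis using that abg(1-3,5) by (auto simp: zero_less_mult_iff mult_less_0_iff neq_iff)
  qed
  then show ?thesis
  proof cases
    case 1
    have "a / g + a / b = a * (1 / a)" unfolding abg(4) by (simp add: distrib_left)
    then have sum1: "a / g + a / b = 1" using abg(1) by simp
    have "ln ?G1 \<le> (a / g) * ln ?G3 + (a / b) * ln ?G2"
    proof (rule holder_three_point_ln[OF fin])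
      fix i assume i: "i \<in> I" "0 < w i"
      show "T i powr (-a) * P i powr a \<le> ((T i * S i) powr (-g) * P i powr g) powr (a / g) * (S i powr b) powr (a / b)"
        using sTS[OF i 1(3)] sP[OF i] 1 
        by (simp add: powr_def exp_add[symmetric] ln_mult field_simps)
    qed (use 1 pos sum1 nn in auto)
    then have "ln ?G1 / a \<le> ((a / g) * ln ?G3 + (a / b) * ln ?G2) / a"
      using 1 by (intro divide_right_mono) auto
    then show ?thesis using 1 by (simp add: add_divide_distrib)
  next
    case 2
    have sum1: "(-b) / g + b / a = 1" using abg by (simp add: field_simps)
    have "ln ?G2 \<le> ((-b) / g) * ln ?G3 + (b / a) * ln ?G1"
    proof (rule holder_three_point_ln[OF fin])
      fix i assume i: "i \<in> I" "0 < w i"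
      show "S i powr b \<le> ((T i * S i) powr (-g) * P i powr g) powr ((-b) / g) * (T i powr (-a) * P i powr a) powr (b / a)"
        using sTS[OF i 2(3)] sP[OF i] 2 
        by (simp add: powr_def exp_add[symmetric] ln_mult field_simps)
    qed (use 2 pos sum1 nn in \<open>auto simp: divide_neg_neg divide_pos_neg divide_neg_pos\<close>)
    then have "ln ?G2 / (-b) \<le> (((-b) / g) * ln ?G3 + (b / a) * ln ?G1) / (-b)"
      using 2 by (intro divide_right_mono) auto
    then show ?thesis using 2 by (simp add: add_divide_distrib diff_divide_distrib)
  next
    case 3
    have sum1: "(-g) / b + g / a = 1" using abg by (simp add: field_simps)
    have "ln ?G3 \<le> ((-g) / b) * ln ?G2 + (g / a) * ln ?G1"
    proof (rule holder_three_point_ln[OF fin])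
      fix i assume i: "i \<in> I" "0 < w i"
      show "(T i * S i) powr (-g) * P i powr g \<le> (S i powr b) powr ((-g) / b) * (T i powr (-a) * P i powr a) powr (g / a)"
      \<comment> \<open>For \<open>g < 0\<close> zeros of \<open>T\<close> or \<open>S\<close> may
        carry weight, but there the left side is 0 by the \<open>powr\<close> convention.\<close>
      proof (cases "T i = 0 \<or> S i = 0 \<or> P i = 0")
        case False
        then have "T i > 0" "S i > 0" "P i > 0" using nn[OF i(1)] by auto
        then show ?thesis using 3 
          by (simp add: powr_def exp_add[symmetric] ln_mult field_simps)
      qed auto
    qed (use 3 pos sum1 nn in \<open>auto simp: divide_neg_neg divide_pos_neg divide_neg_pos\<close>)
    then have "ln ?G3 / (-g) \<le> (((-g) / b) * ln ?G2 + (g / a) * ln ?G1) / (-g)"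
      using 3 by (intro divide_right_mono) auto
    then show ?thesis using 3 by (simp add: add_divide_distrib diff_divide_distrib)
  qed
qed

text \<open>The same three Hoelder inequalities, but the exponent of the middle term now has the
  opposite sign, which turns the conclusion round. The support hypotheses are those of a
  \<open>\<sigma>\<close> that vanishes only where the B marginal does (\<open>sS\<close>) and of a
  kernel inclusion that is available only for \<open>a > 0\<close> (\<open>sT\<close>).\<close>

lemma collinear_exponents_neg:
  fixes w T S P :: "'i \<Rightarrow> real"
  assumes fin: "finite I" and abg: "a \<noteq> 0" "b \<noteq> 0" "g \<noteq> 0" "1 / a = 1 / b + 1 / g" "a * b * g < 0"
    and nn: "\<And>i. i \<in> I \<Longrightarrow> 0 \<le> w i" "\<And>i. i \<in> I \<Longrightarrow> 0 \<le> T i" "\<And>i. i \<in> I \<Longrightarrow> 0 \<le> S i" "\<And>i. i \<in> I \<Longrightarrow> 0 \<le> P i"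
    and sP: "\<And>i. i \<in> I \<Longrightarrow> 0 < w i \<Longrightarrow> 0 < T i \<Longrightarrow> 0 < S i \<Longrightarrow> 0 < P i"
    and sS: "\<And>i. i \<in> I \<Longrightarrow> 0 < w i \<Longrightarrow> 0 < S i"
    and sT: "\<And>i. i \<in> I \<Longrightarrow> 0 < w i \<Longrightarrow> 0 < a \<Longrightarrow> 0 < T i"
    and ne: "i0 \<in> I" "0 < w i0" "0 < T i0"
  shows "ln (\<Sum>i\<in>I. w i * ((T i * S i) powr (-g) * P i powr g)) / g + ln (\<Sum>i\<in>I. w i * S i powr b) / b
     \<le> ln (\<Sum>i\<in>I. w i * (T i powr (-a) * P i powr a)) / a"
    (is "ln ?G3 / g + ln ?G2 / b \<le> ln ?G1 / a")
proof -
  have S0: "0 < S i0" using sS ne by auto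
  have P0: "0 < P i0" using sP ne S0 by auto
  have pos: "0 < ?G1" "0 < ?G2" "0 < ?G3"
    using ne P0 S0 nn by (auto intro!: sum_pos2[OF fin ne(1)])
  consider "a < 0" "b < 0" "g < 0" | "a > 0" "b > 0" "g < 0" | "a > 0" "b < 0" "g > 0"
  proof -
    have "\<not> (a < 0 \<and> b > 0 \<and> g > 0)"
    proof
      assume "a < 0 \<and> b > 0 \<and> g > 0"
      then have "1 / a < 0" "1 / b > 0" "1 / g > 0" by auto
      then show False using abg(4) by linarith
    qed
    then show thesis using that abg(1-3,5) by (auto simp: zero_less_mult_iff mult_less_0_iff neq_iff)
  qed
  then show ?thesis
  proof cases
    case 1
    have "a / g + a / b = a * (1 / a)" unfolding abg(4) by (simp add: distrib_left)
    then have sum1: "a / g + a / b = 1" using abg(1) by simp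
    have "ln ?G1 \<le> (a / g) * ln ?G3 + (a / b) * ln ?G2"
    proof (rule holder_three_point_ln[OF fin])
      fix i assume i: "i \<in> I" "0 < w i"
      show "T i powr (-a) * P i powr a \<le> ((T i * S i) powr (-g) * P i powr g) powr (a / g) * (S i powr b) powr (a / b)"
      proof (cases "T i = 0 \<or> P i = 0")
        case False
        then have "T i > 0" "S i > 0" "P i > 0" using nn[OF i(1)] sS[OF i] by auto
        then show ?thesis using 1 
          by (simp add: powr_def exp_add[symmetric] ln_mult field_simps)
      qed auto
    qed (use 1 pos sum1 nn in \<open>auto simp: divide_neg_neg divide_pos_neg divide_neg_pos\<close>)
    then have "ln ?G1 / (-a) \<le> ((a / g) * ln ?G3 + (a / b) * ln ?G2) / (-a)"
      using 1 by (intro divide_right_mono) auto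
    then show ?thesis using 1 by (simp add: add_divide_distrib diff_divide_distrib)
  next
    case 2
    have sum1: "b / a + (-b) / g = 1" using abg by (simp add: field_simps)
    have "ln ?G2 \<le> (b / a) * ln ?G1 + ((-b) / g) * ln ?G3"
    proof (rule holder_three_point_ln[OF fin])
      fix i assume i: "i \<in> I" "0 < w i"
      show "S i powr b \<le> (T i powr (-a) * P i powr a) powr (b / a) * ((T i * S i) powr (-g) * P i powr g) powr ((-b) / g)"
        using sS[OF i] sT[OF i 2(1)] sP[OF i] 2 
        by (simp add: powr_def exp_add[symmetric] ln_mult field_simps)
    qed (use 2 pos sum1 nn in \<open>auto simp: divide_neg_neg divide_pos_neg divide_neg_pos\<close>)
    then have "ln ?G2 / b \<le> ((b / a) * ln ?G1 + ((-b) / g) * ln ?G3) / b"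
      using 2 by (intro divide_right_mono) auto
    then show ?thesis using 2 by (simp add: add_divide_distrib diff_divide_distrib)
  next
    case 3
    have sum1: "g / a + (-g) / b = 1" using abg by (simp add: field_simps)
    have "ln ?G3 \<le> (g / a) * ln ?G1 + ((-g) / b) * ln ?G2"
    proof (rule holder_three_point_ln[OF fin])
      fix i assume i: "i \<in> I" "0 < w i"
      show "(T i * S i) powr (-g) * P i powr g \<le> (T i powr (-a) * P i powr a) powr (g / a) * (S i powr b) powr ((-g) / b)"
        using sS[OF i] sT[OF i 3(1)] sP[OF i] 3 
        by (simp add: powr_def exp_add[symmetric] ln_mult field_simps)
    qed (use 3 pos sum1 nn in \<open>auto simp: divide_neg_neg divide_pos_neg divide_neg_pos\<close>)
    then have "ln ?G3 / g \<le> ((g / a) * ln ?G1 + ((-g) / b) * ln ?G2) / g"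
      using 3 by (intro divide_right_mono) auto
    then show ?thesis using 3 by (simp add: add_divide_distrib diff_divide_distrib)
  qed
qed

subsection \<open>Power traces and their variational formula\<close>

text \<open>With eigenbasis and eigenvalue list kept apart, powers, products, tensor products,
  images and kernels become pointwise statements about \<open>d\<close>.\<close>

definition unitary_diag :: "complex mat \<Rightarrow> (nat \<Rightarrow> real) \<Rightarrow> complex mat" where
  "unitary_diag U d = U * mat_diag (dim_row U) (\<lambda>i. complex_of_real (d i)) * adjoint U"

lemma unitary_diag_carrier [simp]: "U \<in> carrier_mat n n \<Longrightarrow> unitary_diag U d \<in> carrier_mat n n"
  by (auto simp: unitary_diag_def)

lemma unitary_diag_index:
  assumes "U \<in> carrier_mat n n" "i < n" "j < n"
  shows "unitary_diag U d $$ (i,j) = (\<Sum>k<n. U $$ (i,k) * complex_of_real (d k) * cnj (U $$ (j,k)))"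
  using assms unfolding unitary_diag_def
  by (subst mult_adjoint_index[of _ n n _ n]) (auto simp: mat_diag_mult_right[OF assms(1)] intro!: sum.cong)

lemma unitary_diag_conj:
  assumes "U \<in> carrier_mat n n" "A \<in> carrier_mat n m"
  shows "adjoint A * unitary_diag U d * A
       = adjoint (adjoint U * A) * mat_diag n (\<lambda>i. complex_of_real (d i)) * (adjoint U * A)"
  using conj_conj[of "mat_diag n (\<lambda>i. complex_of_real (d i))" n "adjoint U" n A m] assms
  by (simp add: unitary_diag_def)

lemma unitary_diag_conj_unitary:
  assumes "unitary U n"
  shows "adjoint U * unitary_diag U d * U = mat_diag n (\<lambda>i. complex_of_real (d i))"
  using unitary_diag_conj[of U n U n d] unitaryD[OF assms] adjoint_mult[of "1\<^sub>m n" "1\<^sub>m n"] unitaryD[OF unitary_one, of n]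
  by (simp add: right_mult_one_mat[of _ n n] left_mult_one_mat[of _ n n])

text \<open>The source of all nonnegative weight arrays below: a diagonal entry is linear in the
  eigenvalues, with squared moduli as coefficients.\<close>

lemma unitary_diag_quadratic:
  assumes "U \<in> carrier_mat n n" "A \<in> carrier_mat n m" "k < m"
  shows "(adjoint A * unitary_diag U d * A) $$ (k,k)
     = complex_of_real (\<Sum>r<n. (cmod ((adjoint U * A) $$ (r,k)))\<^sup>2 * d r)"
proof -
  define B where "B = adjoint U * A"
  have B: "B \<in> carrier_mat n m" using assms by (auto simp: B_def)
  let ?D = "mat_diag n (\<lambda>i. complex_of_real (d i))"
  have "(adjoint B * ?D * B) $$ (k,k) = (adjoint B * (?D * B)) $$ (k,k)"
    using B by (simp add: assoc_mult_mat[of _ m n _ n _ m])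
  also have "\<dots> = (\<Sum>r<n. cnj (B $$ (r,k)) * (?D * B) $$ (r,k))"
    using B assms(3) by (intro adjoint_mult_index[of _ _ m _ m]) (auto simp: mat_diag_mult_left[OF B])
  also have "\<dots> = complex_of_real (\<Sum>r<n. (cmod (B $$ (r,k)))\<^sup>2 * d r)"
    unfolding of_real_sum using B assms(3)
    by (intro sum.cong) (auto simp: mat_diag_mult_left[OF B] complex_norm_square simp del: of_real_power)
  finally show ?thesis using unitary_diag_conj[OF assms(1,2)] by (simp add: B_def)
qed

lemma unitary_diag_eq_mult_adjoint:
  assumes "U \<in> carrier_mat n n" "\<And>i. i < n \<Longrightarrow> 0 \<le> d i"
  defines "K \<equiv> U * mat_diag n (\<lambda>i. complex_of_real (sqrt (d i)))"
  shows "K \<in> carrier_mat n n" "unitary_diag U d = K * adjoint K"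
proof -
  show K: "K \<in> carrier_mat n n" using assms(1) by (auto simp: K_def)
  show "unitary_diag U d = K * adjoint K"
  proof (rule eq_matI)
    fix i j assume "i < dim_row (K * adjoint K)" "j < dim_col (K * adjoint K)"
    then have ij: "i < n" "j < n" using K by auto
    have "(K * adjoint K) $$ (i,j) = (\<Sum>k<n. U $$ (i,k) * (complex_of_real (sqrt (d k)) * complex_of_real (sqrt (d k))) * cnj (U $$ (j,k)))"
      using ij assms(1) by (subst mult_adjoint_index[OF K K]) (auto simp: K_def mat_diag_mult_right[OF assms(1)] intro!: sum.cong)
    also have "\<dots> = unitary_diag U d $$ (i,j)"
      unfolding unitary_diag_index[OF assms(1) ij] of_real_mult[symmetric]
      using assms(2) by (intro sum.cong) auto
    finally show "unitary_diag U d $$ (i,j) = (K * adjoint K) $$ (i,j)" by simp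
  qed (use assms(1) K in \<open>auto simp: unitary_diag_def\<close>)
qed

lemma psd_unitary_diag:
  "U \<in> carrier_mat n n \<Longrightarrow> (\<And>i. i < n \<Longrightarrow> 0 \<le> d i) \<Longrightarrow> psd (unitary_diag U d) n"
  using unitary_diag_eq_mult_adjoint[of U n d] psd_mult_adjoint by metis

lemma psd_unitary_diagE:
  assumes "psd M n"
  obtains U d where "unitary U n" "\<And>i. 0 \<le> d i" "M = unitary_diag U d"
proof -
  obtain U d where U: "unitary U n" "\<And>i. 0 \<le> d i" "M = U * mat_diag n (\<lambda>i. complex_of_real (d i)) * adjoint U"
    using psd_spectral[OF assms] by blast
  moreover have "dim_row U = n" using unitaryD(1)[OF U(1)] by auto
  ultimately show thesis using that[of U d] by (simp add: unitary_diag_def)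
qed

lemma mtrace_unitary_diag:
  assumes "unitary U n"
  shows "mtrace (unitary_diag U d) = complex_of_real (\<Sum>i<n. d i)"
proof -
  note U = unitaryD(1)[OF assms]
  have "mtrace (unitary_diag U d) = (\<Sum>i<n. \<Sum>k<n. complex_of_real ((cmod (U $$ (i,k)))\<^sup>2 * d k))"
    unfolding mtrace_def carrier_matD(1)[OF unitary_diag_carrier[OF U]]
    by (auto simp: unitary_diag_index[OF U] complex_norm_square mult_ac simp del: of_real_power intro!: sum.cong)
  also have "\<dots> = (\<Sum>k<n. complex_of_real ((\<Sum>i<n. (cmod (U $$ (i,k)))\<^sup>2) * d k))"
    by (subst sum.swap) (simp add: sum_distrib_right)
  also have "\<dots> = complex_of_real (\<Sum>i<n. d i)"
    using unitary_col_norm[OF assms] by (auto intro!: sum.cong)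
  finally show ?thesis .
qed

text \<open>\<open>mat_power\<close> picks its decomposition by \<open>SOME\<close>, so its value
  must not depend on the choice. The change of basis \<open>W = V^* U\<close> satisfies
  \<open>e i * W_ij = W_ij * d j\<close>; where \<open>W_ij\<close> is nonzero the eigenvalues
  agree, hence so do their images under any \<open>f\<close>.\<close>

lemma unitary_diag_map_eq:
  assumes U: "unitary U n" and V: "unitary V n" and eq: "unitary_diag U d = unitary_diag V e"
  shows "unitary_diag U (\<lambda>i. f (d i)) = unitary_diag V (\<lambda>i. f (e i))"
proof -
  note Uu = unitaryD[OF U] and Vu = unitaryD[OF V]
  define W where "W = adjoint V * U"
  have W: "W \<in> carrier_mat n n" using Uu Vu by (auto simp: W_def)
  let ?D = "\<lambda>d. mat_diag n (\<lambda>i. complex_of_real (d i))"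
  have VW: "V * W = U" using unitary_cancel(2)[OF V Uu(1)] by (simp add: W_def)
  have key: "complex_of_real (e i) * W $$ (i,j) = W $$ (i,j) * complex_of_real (d j)" if "i < n" "j < n" for i j
  proof -
    have "?D e * W = W * ?D d"
    proof -
      have "?D e * W = adjoint V * unitary_diag V e * V * (adjoint V * U)"
        using unitary_diag_conj_unitary[OF V] by (simp add: W_def)
      also have "\<dots> = adjoint V * (unitary_diag V e * U)"
        using Uu Vu by (simp add: assoc_mult_mat[of _ n n _ n _ n] unitary_cancel[OF V, of _ n] mult_carrier_mat[of _ n n _ n])
      also have "\<dots> = adjoint V * (unitary_diag U d * U)" by (simp add: eq)
      also have "\<dots> = adjoint V * U * (adjoint U * unitary_diag U d * U)"
        using Uu Vu by (simp add: assoc_mult_mat[of _ n n _ n _ n] unitary_cancel[OF U, of _ n] mult_carrier_mat[of _ n n _ n])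
      also have "\<dots> = W * ?D d" using unitary_diag_conj_unitary[OF U] by (simp add: W_def)
      finally show ?thesis .
    qed
    then have "(?D e * W) $$ (i,j) = (W * ?D d) $$ (i,j)" by simp
    then show ?thesis using that by (simp add: mat_diag_mult_left[OF W] mat_diag_mult_right[OF W])
  qed
  have "?D (\<lambda>i. f (e i)) * W = W * ?D (\<lambda>i. f (d i))"
  proof (rule eq_matI)
    fix i j assume "i < dim_row (W * ?D (\<lambda>i. f (d i)))" "j < dim_col (W * ?D (\<lambda>i. f (d i)))"
    then have ij: "i < n" "j < n" using W by (auto simp: mat_diag_mult_right[OF W])
    have "W $$ (i,j) = 0 \<or> e i = d j" using key[OF ij] by (auto simp: mult.commute)
    then show "(?D (\<lambda>i. f (e i)) * W) $$ (i,j) = (W * ?D (\<lambda>i. f (d i))) $$ (i,j)"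
      using ij by (auto simp: mat_diag_mult_left[OF W] mat_diag_mult_right[OF W])
  qed (auto simp: mat_diag_mult_left[OF W] mat_diag_mult_right[OF W])
  then have *: "V * (?D (\<lambda>i. f (e i)) * W) * adjoint U = V * (W * ?D (\<lambda>i. f (d i))) * adjoint U"
    by simp
  have WU: "W * adjoint U = adjoint V"
    using Uu Vu by (simp add: W_def assoc_mult_mat[of _ n n _ n _ n] right_mult_one_mat[of _ n n])
  have "V * (?D (\<lambda>i. f (e i)) * W) * adjoint U = V * (?D (\<lambda>i. f (e i)) * (W * adjoint U))"
    using Uu Vu W by (simp add: assoc_mult_mat[of _ n n _ n _ n] mult_carrier_mat[of _ n n _ n])
  also have "\<dots> = unitary_diag V (\<lambda>i. f (e i))"
    unfolding WU using Vu by (simp add: unitary_diag_def assoc_mult_mat[of _ n n _ n _ n])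
  finally have "unitary_diag V (\<lambda>i. f (e i)) = V * (W * ?D (\<lambda>i. f (d i))) * adjoint U"
    using * by simp
  also have "\<dots> = V * W * (?D (\<lambda>i. f (d i)) * adjoint U)"
    using Uu Vu W by (simp add: assoc_mult_mat[of _ n n _ n _ n] mult_carrier_mat[of _ n n _ n])
  also have "\<dots> = unitary_diag U (\<lambda>i. f (d i))"
    unfolding VW using Uu by (simp add: unitary_diag_def assoc_mult_mat[of _ n n _ n _ n])
  finally show ?thesis by simp
qed

lemma mat_power_unitary_diag:
  assumes U: "unitary U n" and d: "\<And>i. i < n \<Longrightarrow> 0 \<le> d i"
  shows "mat_power (unitary_diag U d) p = unitary_diag U (\<lambda>i. d i powr p)"
proof -
  let ?M = "unitary_diag U d"
  have n: "dim_row ?M = n" "dim_row U = n" using unitaryD(1)[OF U] by (auto simp: unitary_diag_def)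
  let ?P = "\<lambda>(V, e). unitary V n \<and> (\<forall>i<n. 0 \<le> e i) \<and> ?M = V * mat_diag n (\<lambda>i. complex_of_real (e i)) * adjoint V"
  obtain V e where Ve: "(SOME x. ?P x) = (V, e)" by (rule prod.exhaust[of "SOME x. ?P x"])
  have "?P (U, d)" using U d n by (simp add: unitary_diag_def)
  then have "?P (SOME x. ?P x)" by (rule someI)
  then have V: "unitary V n" "?M = V * mat_diag n (\<lambda>i. complex_of_real (e i)) * adjoint V"
    unfolding Ve by auto
  have nV: "dim_row V = n" using unitaryD(1)[OF V(1)] by auto
  have "mat_power ?M p = unitary_diag V (\<lambda>i. e i powr p)"
    unfolding mat_power_def Let_def n Ve by (simp add: unitary_diag_def nV)
  also have "\<dots> = unitary_diag U (\<lambda>i. d i powr p)"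
    using V(2) nV by (intro unitary_diag_map_eq[OF V(1) U, where f = "\<lambda>x. x powr p"]) (simp add: unitary_diag_def)
  finally show ?thesis .
qed

definition tr_power :: "complex mat \<Rightarrow> real \<Rightarrow> real" where
  "tr_power M p = Re (mtrace (mat_power M p))"

lemma tr_power_unitary_diag:
  assumes "unitary U n" "\<And>i. i < n \<Longrightarrow> 0 \<le> d i"
  shows "tr_power (unitary_diag U d) p = (\<Sum>i<n. d i powr p)"
  using mtrace_unitary_diag[OF assms(1)] mat_power_unitary_diag[OF assms] by (simp add: tr_power_def)

text \<open>In singular-vector bases of $K$ the matrix $W$ intertwines the spectra of $K K^*$ and $K^* K$,
  so $W_{ij} \neq 0$ forces equality of the corresponding eigenvalues.\<close>

lemma tr_power_swap:
  assumes K: "K \<in> carrier_mat n n"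
  shows "tr_power (K * adjoint K) p = tr_power (adjoint K * K) p"
proof -
  have aK: "adjoint K \<in> carrier_mat n n" using K by simp
  obtain U d where U: "unitary U n" "\<And>i. 0 \<le> d i" "K * adjoint K = unitary_diag U d"
    using psd_unitary_diagE[OF psd_mult_adjoint[OF K]] by blast
  obtain V e where V: "unitary V n" "\<And>i. 0 \<le> e i" "adjoint K * K = unitary_diag V e"
    using psd_unitary_diagE[OF psd_mult_adjoint[OF aK]] by auto
  note Uu = unitaryD[OF U(1)] and Vu = unitaryD[OF V(1)]
  note a = assoc_mult_mat[of _ n n _ n _ n] mult_carrier_mat[of _ n n _ n]
  define W where "W = adjoint U * K * V"
  have W: "W \<in> carrier_mat n n" using Uu Vu K by (auto simp: W_def)
  have aW: "adjoint W = adjoint V * (adjoint K * U)" using Uu Vu K by (simp add: W_def adjoint_mult)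
  let ?D = "\<lambda>d. mat_diag n (\<lambda>i. complex_of_real (d i))"
  have WW: "W * adjoint W = ?D d"
  proof -
    have "W * adjoint W = adjoint U * (K * adjoint K) * U"
      unfolding aW unfolding W_def using Uu Vu K aK by (simp add: a unitary_cancel[OF V(1), of _ n])
    then show ?thesis using unitary_diag_conj_unitary[OF U(1)] U(3) by simp
  qed
  have W'W: "adjoint W * W = ?D e"
  proof -
    have "adjoint W * W = adjoint V * (adjoint K * K) * V"
      unfolding aW unfolding W_def using Uu Vu K aK by (simp add: a unitary_cancel[OF U(1), of _ n])
    then show ?thesis using unitary_diag_conj_unitary[OF V(1)] V(3) by simp
  qed
  have comm: "?D d * W = W * ?D e"
    unfolding WW[symmetric] W'W[symmetric] using W by (simp add: a)
  have eq: "W $$ (i,j) = 0 \<or> d i = e j" if "i < n" "j < n" for i j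
    using arg_cong[OF comm, of "\<lambda>M. M $$ (i,j)"] that
    by (auto simp: mat_diag_mult_left[OF W] mat_diag_mult_right[OF W])
  have di: "d i = (\<Sum>j<n. (cmod (W $$ (i,j)))\<^sup>2)" if "i < n" for i
  proof -
    have "complex_of_real (d i) = (W * adjoint W) $$ (i,i)" using WW that by (simp add: mat_diag_def)
    also have "\<dots> = complex_of_real (\<Sum>j<n. (cmod (W $$ (i,j)))\<^sup>2)"
      unfolding mult_adjoint_index[OF W W that that] of_real_sum by (intro sum.cong) (simp_all add: complex_norm_square del: of_real_power)
    finally show ?thesis using of_real_eq_iff by blast
  qed
  have ej: "e j = (\<Sum>i<n. (cmod (W $$ (i,j)))\<^sup>2)" if "j < n" for j
  proof -
    have "complex_of_real (e j) = (adjoint W * W) $$ (j,j)" using W'W that by (simp add: mat_diag_def)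
    also have "\<dots> = complex_of_real (\<Sum>i<n. (cmod (W $$ (i,j)))\<^sup>2)"
      unfolding adjoint_mult_index[OF W W that that] of_real_sum by (intro sum.cong) (simp_all add: complex_norm_square mult.commute del: of_real_power)
    finally show ?thesis using of_real_eq_iff by blast
  qed
  \<comment> \<open>Splitting off one factor (at 0 both sides are 0) exposes \<open>d i\<close> as a
    row sum of \<open>|W_ij|^2\<close>; the other factor can then be exchanged between
    \<open>d i\<close> and \<open>e j\<close> wherever \<open>W_ij\<close> is nonzero.\<close>
  have pw: "x powr p = x powr (p - 1) * x" if "0 \<le> x" for x :: real
    using that powr_add[of x "p - 1" 1] by (cases "x = 0") auto
  have "(\<Sum>i<n. d i powr p) = (\<Sum>i<n. d i powr (p - 1) * (\<Sum>j<n. (cmod (W $$ (i,j)))\<^sup>2))"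
    by (intro sum.cong refl) (simp add: di[symmetric] pw[OF U(2), symmetric])
  also have "\<dots> = (\<Sum>i<n. \<Sum>j<n. e j powr (p - 1) * (cmod (W $$ (i,j)))\<^sup>2)"
    unfolding sum_distrib_left using eq by (intro sum.cong refl) force
  also have "\<dots> = (\<Sum>j<n. e j powr (p - 1) * (\<Sum>i<n. (cmod (W $$ (i,j)))\<^sup>2))"
    by (subst sum.swap) (simp add: sum_distrib_left)
  also have "\<dots> = (\<Sum>j<n. e j powr p)"
    by (intro sum.cong refl) (simp add: ej[symmetric] pw[OF V(2), symmetric])
  finally show ?thesis unfolding U(3) V(3) using U V by (simp add: tr_power_unitary_diag)
qed

text \<open>A positive diagonal entry forces a positive eigenvalue, and no eigenvalue contributes
  negatively; this supplies the positive arguments of the logarithms.\<close>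

lemma tr_power_pos:
  assumes M: "psd M n" and k: "k < n" "0 < Re (M $$ (k,k))"
  shows "0 < tr_power M p"
proof -
  obtain U d where U: "unitary U n" "\<And>i. 0 \<le> d i" "M = unitary_diag U d"
    using psd_unitary_diagE[OF M] by blast
  have "\<exists>i<n. d i \<noteq> 0"
  proof (rule ccontr)
    assume "\<not> ?thesis"
    then have "M $$ (k,k) = 0" unfolding U(3) unitary_diag_index[OF unitaryD(1)[OF U(1)] k(1) k(1)] by simp
    then show False using k by simp
  qed
  then obtain i where i: "i < n" "d i > 0" using U(2) by (metis less_eq_real_def)
  show ?thesis unfolding U(3) tr_power_unitary_diag[OF U(1,2)]
    by (rule sum_pos2[of _ i]) (use i in auto)
qed

text \<open>The condition on $P$ for $p < 1$ is needed because $0$ powr a negative exponent is $0$.\<close>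

lemma tr_power_variational:
  assumes M: "psd M n" and G: "unitary G n" and p: "0 < p" "p \<noteq> 1"
    and o: "\<And>k. k < n \<Longrightarrow> 0 \<le> P k" "(\<Sum>k<n. P k) = 1"
    and m: "\<And>k. k < n \<Longrightarrow> m k = Re ((adjoint G * M * G) $$ (k,k))"
    and supp: "\<And>k. k < n \<Longrightarrow> p < 1 \<Longrightarrow> P k = 0 \<Longrightarrow> m k = 0"
    and pos: "0 < (\<Sum>k<n. m k * P k powr ((p - 1) / p))"
  shows "ln (\<Sum>k<n. m k * P k powr ((p - 1) / p)) / ((p - 1) / p) \<le> ln (tr_power M p) / (p - 1)"
proof -
  obtain U d where U: "unitary U n" "\<And>i. 0 \<le> d i" "M = unitary_diag U d"
    using psd_unitary_diagE[OF M] by blast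
  define B where "B = adjoint U * G"
  \<comment> \<open>Squared moduli of the unitary \<open>U^* G\<close>: rows and columns sum to 1,
    so both \<open>P\<close> and \<open>d powr p\<close> can be summed over the same pairs without
    changing their totals.\<close>
  define w where "w = (\<lambda>(k,i). (cmod (B $$ (i,k)))\<^sup>2)"
  have B: "unitary B n" unfolding B_def using U(1) G by (intro unitary_mult unitary_adjoint)
  have mk: "m k = (\<Sum>i<n. w (k,i) * d i)" if "k < n" for k
    using unitary_diag_quadratic[OF unitaryD(1)[OF U(1)] unitaryD(1)[OF G] that, of d] m[OF that] U(3)
    by (simp add: B_def w_def)
  let ?I = "{..<n} \<times> {..<n}"
  let ?r = "(p - 1) / p"
  have sP: "(\<Sum>(k,i)\<in>?I. w (k,i) * P k) = 1"
    using o(2) unitary_col_norm[OF B] 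
    by (simp add: sum.cartesian_product[symmetric] w_def sum_distrib_right[symmetric])
  have sd: "(\<Sum>(k,i)\<in>?I. w (k,i) * d i powr p) = tr_power M p"
    unfolding U(3) tr_power_unitary_diag[OF U(1,2)]
    using unitary_row_norm[OF B]
    by (subst sum.cartesian_product[symmetric], subst sum.swap) (simp add: w_def sum_distrib_right[symmetric])
  have sm: "(\<Sum>(k,i)\<in>?I. w (k,i) * (d i * P k powr ?r)) = (\<Sum>k<n. m k * P k powr ?r)"
    using mk by (simp add: sum.cartesian_product[symmetric] sum_distrib_right mult.assoc)
  have "\<exists>k<n. 0 < m k"
  proof (rule ccontr)
    assume "\<not> ?thesis"
    then have "m k \<le> 0" if "k < n" for k using that by (meson not_less)
    then have "(\<Sum>k<n. m k * P k powr ?r) \<le> 0" by (intro sum_nonpos mult_nonpos_nonneg) (auto simp: not_le not_less)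
    then show False using pos by simp
  qed
  then have tp: "0 < tr_power M p"
  proof -
    obtain k where k: "k < n" "0 < m k" using \<open>\<exists>k<n. 0 < m k\<close> by blast
    have "\<exists>i<n. d i \<noteq> 0"
    proof (rule ccontr)
      assume "\<not> ?thesis"
      then show False using mk[OF k(1)] k by simp
    qed
    then obtain i where i: "i < n" "d i > 0" using U(2) by (metis less_eq_real_def)
    show ?thesis unfolding U(3) tr_power_unitary_diag[OF U(1,2)]
      by (rule sum_pos2[of _ i]) (use i in auto)
  qed
  note split = case_prod_beta
  show ?thesis
  proof (cases "p > 1")
    case True
    \<comment> \<open>Hoelder with exponents \<open>p\<close> and \<open>p / (p - 1)\<close>; the
      factor coming from \<open>P\<close> is 1.\<close>
    have "ln (\<Sum>x\<in>?I. w x * (d (snd x) * P (fst x) powr ?r))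
      \<le> (1 / p) * ln (\<Sum>x\<in>?I. w x * (d (snd x) powr p)) + ?r * ln (\<Sum>x\<in>?I. w x * P (fst x))"
    proof (rule holder_three_point_ln)
      fix x assume "x \<in> ?I" "0 < w x"
      then show "d (snd x) * P (fst x) powr ?r \<le> (d (snd x) powr p) powr (1 / p) * P (fst x) powr ?r"
        using U(2)[of "snd x"] True by (simp add: powr_powr)
    qed (use True sP sd sm tp pos o in \<open>auto simp: split field_simps, auto simp: w_def split\<close>)
    then have "ln (\<Sum>k<n. m k * P k powr ?r) \<le> (1 / p) * ln (tr_power M p)"
      using sP sd sm by (simp add: split)
    then have "ln (\<Sum>k<n. m k * P k powr ?r) / ?r \<le> ((1 / p) * ln (tr_power M p)) / ?r"
      using True by (intro divide_right_mono) auto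
    then show ?thesis using True by simp
  next
    case False
    then have p1: "p < 1" using p by auto
    \<comment> \<open>For \<open>p < 1\<close> the roles change: \<open>d powr p\<close> is the
      geometric mean of \<open>d * P powr ?r\<close> and \<open>P\<close> with weights
      \<open>p\<close> and \<open>1 - p\<close>, because
      \<open>p * ?r + (1 - p) = 0\<close>.\<close>
    have "ln (\<Sum>x\<in>?I. w x * (d (snd x) powr p))
      \<le> p * ln (\<Sum>x\<in>?I. w x * (d (snd x) * P (fst x) powr ?r)) + (1 - p) * ln (\<Sum>x\<in>?I. w x * P (fst x))"
    proof (rule holder_three_point_ln)
      fix x assume x: "x \<in> ?I" "0 < w x"
      obtain k i where ki: "x = (k,i)" "k < n" "i < n" using x by auto
      show "d (snd x) powr p \<le> (d (snd x) * P (fst x) powr ?r) powr p * P (fst x) powr (1 - p)"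
      proof (cases "d i = 0")
        case False
        then have di: "d i > 0" using U(2)[of i] by simp
        have "P k \<noteq> 0"
        proof
          assume "P k = 0"
          then have "m k = 0" using supp ki p1 by auto
          moreover have "m k > 0" unfolding mk[OF ki(2)]
            by (rule sum_pos2[of _ i]) (use ki x di U(2) in \<open>auto simp: w_def\<close>)
          ultimately show False by simp
        qed
        then have "P k > 0" using o(1)[OF ki(2)] by simp
        then show ?thesis using di p p1 ki
          by (simp add: powr_def exp_add[symmetric] ln_mult field_simps)
      qed (simp add: ki)
    qed (use p p1 sP sd sm tp pos o U(2) in \<open>auto simp: split, auto simp: w_def split\<close>)
    then have "ln (tr_power M p) \<le> p * ln (\<Sum>k<n. m k * P k powr ?r)"
      using sP sd sm by (simp add: split)
    then have "ln (tr_power M p) / (1 - p) \<le> (p * ln (\<Sum>k<n. m k * P k powr ?r)) / (1 - p)"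
      using p1 by (intro divide_right_mono) auto
    moreover have "ln (tr_power M p) / (1 - p) = - (ln (tr_power M p) / (p - 1))"
      by (metis minus_diff_eq minus_divide_right)
    moreover have "(p * ln (\<Sum>k<n. m k * P k powr ?r)) / (1 - p) = - (ln (\<Sum>k<n. m k * P k powr ?r) / ?r)"
      using p p1 by (simp add: field_simps)
    ultimately show ?thesis by linarith
  qed
qed

text \<open>The equality case of Hoelder: the eigenbasis with weights proportional to
  \<open>d powr p\<close>. That the weights vanish exactly with the diagonal entries is exported
  too, since the later support arguments start from it.\<close>

lemma tr_power_variational_attained:
  assumes M: "psd M n" and p: "0 < p" "p \<noteq> 1" and tp: "0 < tr_power M p"
  obtains G P where "unitary G n" "\<And>k. 0 \<le> P k" "(\<Sum>k<n. P k) = 1"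
    "\<And>k. k < n \<Longrightarrow> P k = 0 \<longleftrightarrow> Re ((adjoint G * M * G) $$ (k,k)) = 0"
    "ln (\<Sum>k<n. Re ((adjoint G * M * G) $$ (k,k)) * P k powr ((p - 1) / p)) / ((p - 1) / p)
      = ln (tr_power M p) / (p - 1)"
proof -
  obtain U d where U: "unitary U n" "\<And>i. 0 \<le> d i" "M = unitary_diag U d"
    using psd_unitary_diagE[OF M] by blast
  define Q where "Q = tr_power M p"
  have Q: "Q = (\<Sum>k<n. d k powr p)" unfolding Q_def U(3) tr_power_unitary_diag[OF U(1,2)] ..
  have Q0: "Q > 0" using tp Q_def by simp
  define P where "P k = d k powr p / Q" for k
  have dk: "Re ((adjoint U * M * U) $$ (k,k)) = d k" if "k < n" for k
    using unitary_diag_conj_unitary[OF U(1), of d] U(3) that by (simp add: mat_diag_def)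
  let ?r = "(p - 1) / p"
  have "(\<Sum>k<n. Re ((adjoint U * M * U) $$ (k,k)) * P k powr ?r) = (\<Sum>k<n. d k powr p / Q powr ?r)"
  proof (intro sum.cong refl)
    fix k assume "k \<in> {..<n}"
    then have k: "k < n" by simp
    show "Re ((adjoint U * M * U) $$ (k,k)) * P k powr ?r = d k powr p / Q powr ?r"
    proof (cases "d k = 0")
      case False
      then have "d k > 0" using U(2)[of k] by simp
      moreover have "(d k powr p) powr ?r = d k powr (p - 1)" using p by (simp add: powr_powr)
      ultimately have "d k * (d k powr p) powr ?r = d k powr p"
        using powr_add[of "d k" 1 "p - 1"] by simp
      then show ?thesis using dk[OF k] Q0 by (simp add: P_def powr_divide)
    qed (use dk[OF k] in simp)
  qed
  also have "\<dots> = Q / Q powr ?r" by (simp add: Q sum_divide_distrib)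
  also have "\<dots> = Q powr (1 / p)"
    using Q0 p powr_diff[of Q 1 ?r] by (simp add: field_simps)
  finally have "ln (\<Sum>k<n. Re ((adjoint U * M * U) $$ (k,k)) * P k powr ?r) / ?r = ln Q / (p - 1)"
    using Q0 p by (simp add: ln_powr)
  moreover have "(\<Sum>k<n. P k) = 1" using Q0 by (simp add: P_def sum_divide_distrib[symmetric] Q)
  ultimately show thesis using that[of U P] U dk Q0 by (auto simp: P_def Q_def)
qed

subsection \<open>Tensor products, supports and the divergence\<close>

lemma pair_index_less:
  assumes "i < a" "j < (b::nat)" shows "i * b + j < a * b"
proof -
  have "Suc i * b \<le> a * b" using assms(1) by (intro mult_le_mono1) simp
  then show ?thesis using assms(2) by simp
qed

lemma sum_div_mod:
  fixes f :: "nat \<Rightarrow> nat \<Rightarrow> 'a::comm_monoid_add"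
  shows "(\<Sum>r<a * b. f (r div b) (r mod b)) = (\<Sum>i<a. \<Sum>j<b. f i j)"
proof (cases "b = 0")
  case False
  have "(\<Sum>i<a. \<Sum>j<b. f i j) = (\<Sum>(i,j)\<in>{..<a} \<times> {..<b}. f i j)"
    by (simp add: sum.cartesian_product)
  also have "\<dots> = (\<Sum>r<a * b. f (r div b) (r mod b))"
    using False
    by (intro sum.reindex_bij_witness[where i = "\<lambda>r. (r div b, r mod b)" and j = "\<lambda>(i,j). i * b + j"])
       (auto simp: less_mult_imp_div_less pair_index_less)
  finally show ?thesis ..
qed simp

lemma div_mod_less:
  assumes "r < a * (b::nat)" shows "r div b < a" "r mod b < b"
  using assms by (auto simp: less_mult_imp_div_less intro!: mod_less_divisor) (metis gr0I mult_0_right not_less_zero)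

lemma kron_carrier [simp]:
  "X \<in> carrier_mat a c \<Longrightarrow> Y \<in> carrier_mat b d \<Longrightarrow> kron X Y \<in> carrier_mat (a * b) (c * d)"
  by (auto simp: kron_def)

lemma kron_index:
  assumes "X \<in> carrier_mat a a" "Y \<in> carrier_mat b b" "r < a * b" "c < a * b"
  shows "kron X Y $$ (r,c) = X $$ (r div b, c div b) * Y $$ (r mod b, c mod b)"
  using assms by (auto simp: kron_def)

lemma kron_unitary:
  assumes E: "unitary E a" and F: "unitary F b"
  shows "unitary (kron E F) (a * b)"
proof -
  note Eu = unitaryD[OF E] and Fu = unitaryD[OF F]
  have K: "kron E F \<in> carrier_mat (a * b) (a * b)" using Eu Fu by simp
  have "adjoint (kron E F) * kron E F = 1\<^sub>m (a * b)"
  proof (rule eq_matI)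
    fix r c assume "r < dim_row (1\<^sub>m (a * b))" "c < dim_col (1\<^sub>m (a * b))"
    then have rc: "r < a * b" "c < a * b" by auto
    note rr = div_mod_less[OF rc(1)] and cc = div_mod_less[OF rc(2)]
    have "(adjoint (kron E F) * kron E F) $$ (r,c) =
      (\<Sum>q<a * b. (cnj (E $$ (q div b, r div b)) * E $$ (q div b, c div b)) *
                  (cnj (F $$ (q mod b, r mod b)) * F $$ (q mod b, c mod b)))"
      unfolding adjoint_mult_index[OF K K rc] using rc
      by (intro sum.cong refl) (simp add: kron_index[OF Eu(1) Fu(1)])
    also have "\<dots> = (\<Sum>i<a. cnj (E $$ (i, r div b)) * E $$ (i, c div b)) *
                    (\<Sum>j<b. cnj (F $$ (j, r mod b)) * F $$ (j, c mod b))"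
      unfolding sum_product by (rule sum_div_mod)
    also have "\<dots> = (adjoint E * E) $$ (r div b, c div b) * (adjoint F * F) $$ (r mod b, c mod b)"
      using adjoint_mult_index[OF Eu(1) Eu(1) rr(1) cc(1)] adjoint_mult_index[OF Fu(1) Fu(1) rr(2) cc(2)] by simp
    also have "\<dots> = 1\<^sub>m (a * b) $$ (r,c)"
      using Eu Fu rr cc rc by (auto) (metis div_mult_mod_eq)
    finally show "(adjoint (kron E F) * kron E F) $$ (r,c) = 1\<^sub>m (a * b) $$ (r,c)" .
  qed (use K in auto)
  then show ?thesis using K by (simp add: unitary_def)
qed

lemma kron_unitary_diag:
  assumes E: "unitary E a" and F: "unitary F b"
  shows "kron (unitary_diag E t) (unitary_diag F s) = unitary_diag (kron E F) (\<lambda>r. t (r div b) * s (r mod b))"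
proof -
  note Eu = unitaryD(1)[OF E] and Fu = unitaryD(1)[OF F]
  have K: "kron E F \<in> carrier_mat (a * b) (a * b)" using Eu Fu by simp
  have L: "kron (unitary_diag E t) (unitary_diag F s) \<in> carrier_mat (a * b) (a * b)" using Eu Fu by simp
  have R: "unitary_diag (kron E F) (\<lambda>r. t (r div b) * s (r mod b)) \<in> carrier_mat (a * b) (a * b)" using K by simp
  show ?thesis
  proof (rule eq_matI)
    fix r c assume "r < dim_row (unitary_diag (kron E F) (\<lambda>r. t (r div b) * s (r mod b)))"
      "c < dim_col (unitary_diag (kron E F) (\<lambda>r. t (r div b) * s (r mod b)))"
    then have rc: "r < a * b" "c < a * b" using R by auto
    note rr = div_mod_less[OF rc(1)] and cc = div_mod_less[OF rc(2)]
    have "unitary_diag (kron E F) (\<lambda>r. t (r div b) * s (r mod b)) $$ (r,c) =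
      (\<Sum>q<a * b. (E $$ (r div b, q div b) * complex_of_real (t (q div b)) * cnj (E $$ (c div b, q div b))) *
                  (F $$ (r mod b, q mod b) * complex_of_real (s (q mod b)) * cnj (F $$ (c mod b, q mod b))))"
      unfolding unitary_diag_index[OF K rc] using rc
      by (intro sum.cong refl) (simp add: kron_index[OF Eu(1) Fu(1)])
    also have "\<dots> = (\<Sum>i<a. E $$ (r div b, i) * complex_of_real (t i) * cnj (E $$ (c div b, i))) *
                    (\<Sum>j<b. F $$ (r mod b, j) * complex_of_real (s j) * cnj (F $$ (c mod b, j)))"
      unfolding sum_product by (rule sum_div_mod)
    also have "\<dots> = kron (unitary_diag E t) (unitary_diag F s) $$ (r,c)"
      using unitary_diag_index[OF Eu rr(1) cc(1)] unitary_diag_index[OF Fu rr(2) cc(2)] rc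
        kron_index[of "unitary_diag E t" a "unitary_diag F s" b r c] Eu Fu by simp
    finally show "kron (unitary_diag E t) (unitary_diag F s) $$ (r,c) 
      = unitary_diag (kron E F) (\<lambda>r. t (r div b) * s (r mod b)) $$ (r,c)" by simp
  qed (use L R in auto)
qed

lemma unitary_diag_one: "unitary F b \<Longrightarrow> unitary_diag F (\<lambda>_. 1) = 1\<^sub>m b"
  using unitaryD[of F b] by (auto simp: unitary_diag_def right_mult_one_mat[of _ b b])

lemma kron_unitary_diag_one:
  assumes "unitary E a" "unitary F b"
  shows "kron (unitary_diag E t) (1\<^sub>m b) = unitary_diag (kron E F) (\<lambda>r. t (r div b))"
  using kron_unitary_diag[OF assms, of t "\<lambda>_. 1"] unitary_diag_one[OF assms(2)] by simp

lemma unitary_diag_mult: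
  assumes "unitary V n"
  shows "unitary_diag V d * unitary_diag V e = unitary_diag V (\<lambda>i. d i * e i)"
proof -
  note Vu = unitaryD[OF assms]
  note a = assoc_mult_mat[of _ n n _ n _ n] mult_carrier_mat[of _ n n _ n]
  have n: "dim_row V = n" using Vu by auto
  let ?D = "\<lambda>d. mat_diag n (\<lambda>i. complex_of_real (d i))"
  have "unitary_diag V d * unitary_diag V e = V * (?D d * (?D e * adjoint V))"
    using Vu by (simp add: unitary_diag_def n a unitary_cancel[OF assms, of _ n])
  also have "?D d * (?D e * adjoint V) = ?D (\<lambda>i. d i * e i) * adjoint V"
    using Vu by (simp add: assoc_mult_mat[of _ n n _ n _ n, symmetric])
  also have "V * \<dots> = unitary_diag V (\<lambda>i. d i * e i)"
    using Vu by (simp add: unitary_diag_def n a)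
  finally show ?thesis .
qed

lemma adjoint_unitary_diag:
  assumes "U \<in> carrier_mat n n" shows "adjoint (unitary_diag U d) = unitary_diag U d"
proof -
  have c: "unitary_diag U d \<in> carrier_mat n n" using assms by simp
  show ?thesis
    by (rule eq_matI) (use c in \<open>auto simp: unitary_diag_index[OF assms] mult_ac\<close>)
qed

section \<open>Images and kernels in an eigenbasis\<close>

lemma mult_mat_zero_vec: "A \<in> carrier_mat n m \<Longrightarrow> A *\<^sub>v (0\<^sub>v m :: complex vec) = 0\<^sub>v n"
  by (intro eq_vecI) (auto simp: scalar_prod_def)

lemma unitary_diag_mult_vec:
  assumes V: "unitary V n" and v: "v \<in> carrier_vec n" and r: "r < n"
  shows "(adjoint V *\<^sub>v (unitary_diag V d *\<^sub>v v)) $ r = complex_of_real (d r) * (adjoint V *\<^sub>v v) $ r"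
proof -
  note Vu = unitaryD[OF V]
  have n: "dim_row V = n" using Vu by auto
  let ?D = "mat_diag n (\<lambda>i. complex_of_real (d i))"
  have "unitary_diag V d *\<^sub>v v = V *\<^sub>v (?D *\<^sub>v (adjoint V *\<^sub>v v))"
    using Vu v by (simp add: unitary_diag_def n assoc_mult_mat_vec[of _ n n _ n] mult_carrier_mat[of _ n n _ n]
        mult_mat_vec_carrier[of _ n n])
  then have "adjoint V *\<^sub>v (unitary_diag V d *\<^sub>v v) = ?D *\<^sub>v (adjoint V *\<^sub>v v)"
    using Vu v by (simp add: unitary_cancel_vec[OF V] mult_mat_vec_carrier[of _ n n])
  also have "\<dots> $ r = (\<Sum>k<n. (if r = k then complex_of_real (d k) else 0) * (adjoint V *\<^sub>v v) $ k)"
    using Vu v r by (simp add: mult_mat_vec_def scalar_prod_def atLeast0LessThan mat_diag_def)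
  also have "\<dots> = complex_of_real (d r) * (adjoint V *\<^sub>v v) $ r"
    using r by (simp add: if_distrib[of "\<lambda>x. x * _"] cong: if_cong)
  finally show ?thesis .
qed

lemma mimage_unitary_diag:
  assumes V: "unitary V n"
  shows "mimage (unitary_diag V d) = {v \<in> carrier_vec n. \<forall>r<n. d r = 0 \<longrightarrow> (adjoint V *\<^sub>v v) $ r = 0}"
proof -
  note Vu = unitaryD[OF V]
  have c: "unitary_diag V d \<in> carrier_mat n n" using Vu by simp
  have n: "dim_col (unitary_diag V d) = n" using c by auto
  show ?thesis
  proof (intro equalityI subsetI)
    fix v assume "v \<in> mimage (unitary_diag V d)"
    then obtain u where u: "u \<in> carrier_vec n" "v = unitary_diag V d *\<^sub>v u" by (auto simp: mimage_def n)
    then show "v \<in> {v \<in> carrier_vec n. \<forall>r<n. d r = 0 \<longrightarrow> (adjoint V *\<^sub>v v) $ r = 0}"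
      using c unitary_diag_mult_vec[OF V u(1), of _ d] by (auto simp: mult_mat_vec_carrier[of _ n n])
  next
    fix v assume "v \<in> {v \<in> carrier_vec n. \<forall>r<n. d r = 0 \<longrightarrow> (adjoint V *\<^sub>v v) $ r = 0}"
    then have v: "v \<in> carrier_vec n" "\<And>r. r < n \<Longrightarrow> d r = 0 \<Longrightarrow> (adjoint V *\<^sub>v v) $ r = 0" by auto
    \<comment> \<open>Coordinates of a preimage. Where \<open>d r = 0\<close> the quotient is 0 in
      HOL, which is correct because that coordinate of \<open>v\<close> vanishes.\<close>
    define y where "y = vec n (\<lambda>r. (adjoint V *\<^sub>v v) $ r / complex_of_real (d r))"
    define u where "u = V *\<^sub>v y"
    have y: "y \<in> carrier_vec n" by (simp add: y_def)
    have u: "u \<in> carrier_vec n" using Vu y by (simp add: u_def mult_mat_vec_carrier[of _ n n])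
    have "adjoint V *\<^sub>v (unitary_diag V d *\<^sub>v u) = adjoint V *\<^sub>v v"
    proof (rule eq_vecI)
      fix r assume "r < dim_vec (adjoint V *\<^sub>v v)"
      then have r: "r < n" using Vu by simp
      have "(adjoint V *\<^sub>v (unitary_diag V d *\<^sub>v u)) $ r = complex_of_real (d r) * (adjoint V *\<^sub>v u) $ r"
        by (rule unitary_diag_mult_vec[OF V u r])
      also have "adjoint V *\<^sub>v u = y" using unitary_cancel_vec[OF V y] by (simp add: u_def)
      also have "complex_of_real (d r) * y $ r = (adjoint V *\<^sub>v v) $ r"
        using v(2)[OF r] r by (cases "d r = 0") (auto simp: y_def)
      finally show "(adjoint V *\<^sub>v (unitary_diag V d *\<^sub>v u)) $ r = (adjoint V *\<^sub>v v) $ r" .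
    qed (use Vu c in auto)
    then have "V *\<^sub>v (adjoint V *\<^sub>v (unitary_diag V d *\<^sub>v u)) = V *\<^sub>v (adjoint V *\<^sub>v v)" by simp
    then have "unitary_diag V d *\<^sub>v u = v"
      using unitary_cancel_vec(2)[OF V] v u c by (simp add: mult_mat_vec_carrier[of _ n n])
    then show "v \<in> mimage (unitary_diag V d)" using u by (auto simp: mimage_def n)
  qed
qed

text \<open>At a column of \<open>V\<close> with eigenvalue 0, the quadratic form of
  \<open>C C^*\<close> is the squared norm of the corresponding row of \<open>V^* C\<close>, so
  membership in the kernel means that the row vanishes.\<close>

lemma mkernel_unitary_diag_subset:
  assumes V: "unitary V n" and C: "C \<in> carrier_mat n n"
  shows "mkernel (unitary_diag V d) \<subseteq> mkernel (C * adjoint C)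
     \<longleftrightarrow> (\<forall>r<n. d r = 0 \<longrightarrow> (\<forall>k<n. (adjoint V * C) $$ (r,k) = 0))"
proof -
  note Vu = unitaryD[OF V]
  define A where "A = adjoint V * C"
  have A: "A \<in> carrier_mat n n" using Vu C by (simp add: A_def mult_carrier_mat[of _ n n])
  have aA: "adjoint A = adjoint C * V" using Vu C by (simp add: A_def adjoint_mult)
  have aC: "adjoint C \<in> carrier_mat n n" "C * adjoint C \<in> carrier_mat n n" using C by auto
  have c: "unitary_diag V d \<in> carrier_mat n n" using Vu by simp
  have dims: "dim_col (unitary_diag V d) = n" "dim_row (unitary_diag V d) = n" 
    "dim_col (C * adjoint C) = n" "dim_row (C * adjoint C) = n" using c C by auto
  have VCCV: "adjoint V * (C * adjoint C) * V = A * adjoint A"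
    unfolding aA unfolding A_def using Vu C aC
    by (simp add: assoc_mult_mat[of _ n n _ n _ n] mult_carrier_mat[of _ n n _ n])
  show ?thesis unfolding A_def[symmetric]
  proof
    assume sub: "mkernel (unitary_diag V d) \<subseteq> mkernel (C * adjoint C)"
    show "\<forall>r<n. d r = 0 \<longrightarrow> (\<forall>k<n. A $$ (r,k) = 0)"
    proof (intro allI impI)
      fix r k assume rk: "r < n" "d r = 0" "k < n"
      define v where "v = col V r"
      have v: "v \<in> carrier_vec n" using Vu rk by (auto simp: v_def)
      have "adjoint V *\<^sub>v v = col (adjoint V * V) r"
        unfolding v_def using Vu(1) rk(1) by (intro col_mult2[symmetric, of _ n n _ n]) auto
      then have Vv: "adjoint V *\<^sub>v v = unit_vec n r" unfolding Vu(2) using rk by simp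
      have "adjoint V *\<^sub>v (unitary_diag V d *\<^sub>v v) = 0\<^sub>v n"
        using Vu rk unitary_diag_mult_vec[OF V v, of _ d] by (intro eq_vecI) (auto simp: Vv)
      then have "V *\<^sub>v (adjoint V *\<^sub>v (unitary_diag V d *\<^sub>v v)) = V *\<^sub>v 0\<^sub>v n" by simp
      then have "unitary_diag V d *\<^sub>v v = 0\<^sub>v n"
        using unitary_cancel_vec(2)[OF V] v c Vu mult_mat_zero_vec[OF Vu(1)] by (simp add: mult_mat_vec_carrier[of _ n n])
      then have "v \<in> mkernel (C * adjoint C)" using sub v by (auto simp: mkernel_def dims)
      then have "(C * adjoint C) *\<^sub>v v = 0\<^sub>v n" using C by (auto simp: mkernel_def)
      then have "(adjoint V * (C * adjoint C) * V) $$ (r,r) = 0"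
        unfolding conj_diag_entry[OF aC(2) Vu(1) rk(1)] using v by (simp add: v_def)
      then have "complex_of_real (\<Sum>k<n. (cmod (A $$ (r,k)))\<^sup>2) = 0"
        unfolding VCCV mult_adjoint_index[OF A A rk(1) rk(1)]
        by (simp add: complex_norm_square del: of_real_power)
      then have "(\<Sum>k<n. (cmod (A $$ (r,k)))\<^sup>2) = 0" using of_real_eq_0_iff by blast
      then show "A $$ (r,k) = 0" using rk by (subst (asm) sum_nonneg_eq_0_iff) auto
    qed
  next
    assume z: "\<forall>r<n. d r = 0 \<longrightarrow> (\<forall>k<n. A $$ (r,k) = 0)"
    show "mkernel (unitary_diag V d) \<subseteq> mkernel (C * adjoint C)"
    proof
      fix v assume "v \<in> mkernel (unitary_diag V d)"
      then have v: "v \<in> carrier_vec n" "unitary_diag V d *\<^sub>v v = 0\<^sub>v n" by (auto simp: mkernel_def dims)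
      define y where "y = adjoint V *\<^sub>v v"
      have y: "y \<in> carrier_vec n" using Vu v by (simp add: y_def mult_mat_vec_carrier[of _ n n])
      have dy: "d r = 0 \<or> y $ r = 0" if "r < n" for r
        using unitary_diag_mult_vec[OF V v(1) that, of d] v(2) Vu that by (auto simp: y_def)
      have "adjoint C *\<^sub>v v = adjoint C *\<^sub>v (V *\<^sub>v y)"
        using unitary_cancel_vec[OF V v(1)] by (simp add: y_def)
      also have "\<dots> = adjoint A *\<^sub>v y" unfolding aA using aC Vu y by (simp add: assoc_mult_mat_vec[of _ n n _ n])
      also have "\<dots> = 0\<^sub>v n"
      proof (rule eq_vecI)
        fix k assume "k < dim_vec (0\<^sub>v n :: complex vec)"
        then have k: "k < n" by simp
        have "(adjoint A *\<^sub>v y) $ k = (\<Sum>r<n. cnj (A $$ (r,k)) * y $ r)"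
          using A y k by (simp add: scalar_prod_def atLeast0LessThan)
        also have "\<dots> = (\<Sum>r<n. 0)" using z dy k by (intro sum.cong refl) auto
        finally show "(adjoint A *\<^sub>v y) $ k = 0\<^sub>v n $ k" using k by simp
      qed (use A in auto)
      finally have "(C * adjoint C) *\<^sub>v v = 0\<^sub>v n"
        using C aC v mult_mat_zero_vec[OF C] by (simp add: assoc_mult_mat_vec[of _ n n _ n])
      then show "v \<in> mkernel (C * adjoint C)" using v C by (auto simp: mkernel_def)
    qed
  qed
qed

lemma mimage_mult_adjoint:
  assumes V: "unitary V n" and C: "C \<in> carrier_mat n n" and v: "v \<in> mimage (C * adjoint C)"
  obtains z where "v \<in> carrier_vec n" "z \<in> carrier_vec n"
    "\<And>r. r < n \<Longrightarrow> (adjoint V *\<^sub>v v) $ r = (\<Sum>k<n. (adjoint V * C) $$ (r,k) * z $ k)"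
proof -
  note Vu = unitaryD[OF V]
  have aC: "adjoint C \<in> carrier_mat n n" using C by auto
  obtain x where x: "x \<in> carrier_vec n" "v = C * adjoint C *\<^sub>v x" using v C by (auto simp: mimage_def)
  define z where "z = adjoint C *\<^sub>v x"
  have z: "z \<in> carrier_vec n" using aC x by (simp add: z_def mult_mat_vec_carrier[of _ n n])
  have vz: "v = C *\<^sub>v z" using x C aC by (simp add: z_def assoc_mult_mat_vec[of _ n n _ n])
  have "adjoint V *\<^sub>v v = (adjoint V * C) *\<^sub>v z"
    unfolding vz using Vu C z by (simp add: assoc_mult_mat_vec[of _ n n _ n])
  moreover have "adjoint V * C \<in> carrier_mat n n" using Vu C by (simp add: mult_carrier_mat[of _ n n])
  ultimately have "(adjoint V *\<^sub>v v) $ r = (\<Sum>k<n. (adjoint V * C) $$ (r,k) * z $ k)" if "r < n" for r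
    using z that Vu C by (simp add: scalar_prod_def atLeast0LessThan)
  moreover have "v \<in> carrier_vec n" using C z vz by (simp add: mult_mat_vec_carrier[of _ n n])
  ultimately show thesis using that z by blast
qed

text \<open>Takes a nonzero coordinate of the common vector: one image puts it outside the zero set
  of \<open>d\<close>, the other puts it in a nonzero row of \<open>V^* C\<close>. The resulting
  entry seeds the strict positivity of all later sums.\<close>

lemma common_image_entry:
  assumes V: "unitary V n" and C: "C \<in> carrier_mat n n"
    and v: "v \<in> mimage (C * adjoint C) \<inter> mimage (unitary_diag V d)" "v \<noteq> 0\<^sub>v n"
  obtains r k where "r < n" "k < n" "(adjoint V * C) $$ (r,k) \<noteq> 0" "d r \<noteq> 0"
proof -
  obtain z where z: "v \<in> carrier_vec n" "\<And>r. r < n \<Longrightarrow> (adjoint V *\<^sub>v v) $ r = (\<Sum>k<n. (adjoint V * C) $$ (r,k) * z $ k)"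
    using mimage_mult_adjoint[OF V C] v(1) by blast
  have "adjoint V *\<^sub>v v \<noteq> 0\<^sub>v n"
  proof
    assume "adjoint V *\<^sub>v v = 0\<^sub>v n"
    then have "v = V *\<^sub>v 0\<^sub>v n"
      using unitary_cancel_vec(2)[OF V z(1)] by simp
    also have "\<dots> = 0\<^sub>v n" by (rule mult_mat_zero_vec[OF unitaryD(1)[OF V]])
    finally show False using v(2) by simp
  qed
  then obtain r where r: "r < n" "(adjoint V *\<^sub>v v) $ r \<noteq> 0"
    using unitaryD[OF V] by (metis adjoint_dim(1) carrier_matD(2) dim_mult_mat_vec eq_vecI index_zero_vec)
  have "d r \<noteq> 0" using v(1) r unfolding mimage_unitary_diag[OF V] by auto
  moreover have "\<exists>k<n. (adjoint V * C) $$ (r,k) \<noteq> 0"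
  proof (rule ccontr)
    assume "\<not> ?thesis"
    then show False using z(2)[OF r(1)] r by simp
  qed
  ultimately show thesis using that r by blast
qed

text \<open>The guard of \<open>sandwiched_renyi\<close>, named because it has to be transferred
  between reference operators with and without the B state, and between the orders
  \<open>\<alpha>\<close> and \<open>\<gamma>\<close>.\<close>

definition renyi_finite :: "real \<Rightarrow> complex mat \<Rightarrow> complex mat \<Rightarrow> bool" where
  "renyi_finite \<alpha> \<rho> \<sigma> \<longleftrightarrow> (\<exists>v \<in> mimage \<rho> \<inter> mimage \<sigma>. v \<noteq> 0\<^sub>v (dim_row \<rho>)) \<and>
         (mkernel \<sigma> \<subseteq> mkernel \<rho> \<or> \<alpha> < 1)"

lemma sandwiched_renyi_infinite:
  "\<not> renyi_finite \<alpha> \<rho> \<sigma> \<Longrightarrow> sandwiched_renyi \<alpha> \<rho> \<sigma> = \<infinity>"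
  unfolding sandwiched_renyi_def renyi_finite_def by (rule if_not_P)

text \<open>With \<open>s\<close> the power of the reference operator,
  \<open>s C C^* s = (s C) (s C)^*\<close> has the same power traces as
  \<open>(s C)^* (s C) = C^* s^2 C\<close>. Squaring \<open>s\<close> doubles the exponent of the
  definition to minus the conjugate exponent.\<close>

lemma sandwiched_renyi_unitary_diag:
  assumes V: "unitary V n" and C: "C \<in> carrier_mat n n" and d: "\<And>r. r < n \<Longrightarrow> 0 \<le> d r"
    and \<alpha>: "\<alpha> > 0" and fin: "renyi_finite \<alpha> (C * adjoint C) (unitary_diag V d)"
  shows "sandwiched_renyi \<alpha> (C * adjoint C) (unitary_diag V d) =
    ereal (ln (tr_power (adjoint C * unitary_diag V (\<lambda>r. d r powr (- ((\<alpha> - 1) / \<alpha>))) * C) \<alpha>) / (\<alpha> - 1) / ln 2)"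
proof -
  note Vu = unitaryD[OF V]
  let ?x = "(1 - \<alpha>) / (2 * \<alpha>)"
  define s where "s = unitary_diag V (\<lambda>r. d r powr ?x)"
  have s: "s \<in> carrier_mat n n" "adjoint s = s" using Vu by (auto simp: s_def adjoint_unitary_diag)
  have aC: "adjoint C \<in> carrier_mat n n" using C by simp
  have sp: "mat_power (unitary_diag V d) ?x = s" unfolding s_def using V d by (rule mat_power_unitary_diag)
  have "s * (C * adjoint C) * s = (s * C) * adjoint (s * C)"
    using s C aC by (simp add: adjoint_mult assoc_mult_mat[of _ n n _ n _ n] mult_carrier_mat[of _ n n _ n])
  then have "tr_power (s * (C * adjoint C) * s) \<alpha> = tr_power (adjoint (s * C) * (s * C)) \<alpha>"
    using tr_power_swap[of "s * C" n \<alpha>] s C by simp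
  also have "adjoint (s * C) * (s * C) = adjoint C * (s * s) * C"
    using s C aC by (simp add: adjoint_mult assoc_mult_mat[of _ n n _ n _ n] mult_carrier_mat[of _ n n _ n])
  also have "s * s = unitary_diag V (\<lambda>r. d r powr (- ((\<alpha> - 1) / \<alpha>)))"
  proof -
    have "?x + ?x = - ((\<alpha> - 1) / \<alpha>)" using \<alpha> by (simp add: field_simps)
    then show ?thesis unfolding s_def unitary_diag_mult[OF V] powr_add[symmetric] by simp
  qed
  finally have "tr_power (s * (C * adjoint C) * s) \<alpha> =
    tr_power (adjoint C * unitary_diag V (\<lambda>r. d r powr (- ((\<alpha> - 1) / \<alpha>))) * C) \<alpha>" .
  then show ?thesis
    using fin unfolding sandwiched_renyi_def renyi_finite_def sp Let_def
    by (simp add: tr_power_def[symmetric] log_def)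
qed

subsection \<open>Marginals and the product eigenbasis\<close>

lemma mtrace_ptrace_A:
  assumes "M \<in> carrier_mat (dA * dB) (dA * dB)"
  shows "mtrace (ptrace_A dA dB M) = mtrace M"
proof -
  have "mtrace M = (\<Sum>r<dA * dB. M $$ (r div dB * dB + r mod dB, r div dB * dB + r mod dB))"
    using assms by (simp add: mtrace_def)
  also have "\<dots> = (\<Sum>i<dA. \<Sum>j<dB. M $$ (i * dB + j, i * dB + j))" by (rule sum_div_mod)
  also have "\<dots> = mtrace (ptrace_A dA dB M)"
    by (subst sum.swap) (simp add: mtrace_def ptrace_A_def)
  finally show ?thesis by simp
qed

lemma mtrace_ptrace_B:
  assumes "M \<in> carrier_mat (dA * dB) (dA * dB)"
  shows "mtrace (ptrace_B dA dB M) = mtrace M"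
proof -
  have "mtrace M = (\<Sum>r<dA * dB. M $$ (r div dB * dB + r mod dB, r div dB * dB + r mod dB))"
    using assms by (simp add: mtrace_def)
  also have "\<dots> = (\<Sum>i<dA. \<Sum>j<dB. M $$ (i * dB + j, i * dB + j))" by (rule sum_div_mod)
  also have "\<dots> = mtrace (ptrace_B dA dB M)"
    by (simp add: mtrace_def ptrace_B_def)
  finally show ?thesis by simp
qed

text \<open>Regrouping the entries of $C$ into a wide matrix $K$ turns a marginal of $C C^*$ into $K K^*$.\<close>

lemma psd_ptrace_A:
  assumes C: "C \<in> carrier_mat (dA * dB) N"
  shows "psd (ptrace_A dA dB (C * adjoint C)) dB"
proof -
  define K where "K = mat dB (dA * N) (\<lambda>(j,q). C $$ (q div N * dB + j, q mod N))"
  have K: "K \<in> carrier_mat dB (dA * N)" by (simp add: K_def)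
  have "ptrace_A dA dB (C * adjoint C) = K * adjoint K"
  proof (rule eq_matI)
    fix j l assume "j < dim_row (K * adjoint K)" "l < dim_col (K * adjoint K)"
    then have jl: "j < dB" "l < dB" using K by auto
    have "(K * adjoint K) $$ (j,l) = (\<Sum>q<dA * N. C $$ (q div N * dB + j, q mod N) * cnj (C $$ (q div N * dB + l, q mod N)))"
      unfolding mult_adjoint_index[OF K K jl] using jl by (intro sum.cong refl) (simp add: K_def)
    also have "\<dots> = (\<Sum>i<dA. \<Sum>k<N. C $$ (i * dB + j, k) * cnj (C $$ (i * dB + l, k)))"
      by (rule sum_div_mod)
    also have "\<dots> = (\<Sum>i<dA. (C * adjoint C) $$ (i * dB + j, i * dB + l))"
      using jl by (intro sum.cong refl mult_adjoint_index[OF C C, symmetric]) (auto intro: pair_index_less)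
    finally show "ptrace_A dA dB (C * adjoint C) $$ (j,l) = (K * adjoint K) $$ (j,l)"
      using jl by (simp add: ptrace_A_def)
  qed (use K in \<open>auto simp: ptrace_A_def\<close>)
  then show ?thesis using psd_mult_adjoint[OF K] by simp
qed

lemma psd_ptrace_B:
  assumes C: "C \<in> carrier_mat (dA * dB) N"
  shows "psd (ptrace_B dA dB (C * adjoint C)) dA"
proof -
  define K where "K = mat dA (dB * N) (\<lambda>(i,q). C $$ (i * dB + q div N, q mod N))"
  have K: "K \<in> carrier_mat dA (dB * N)" by (simp add: K_def)
  have "ptrace_B dA dB (C * adjoint C) = K * adjoint K"
  proof (rule eq_matI)
    fix i l assume "i < dim_row (K * adjoint K)" "l < dim_col (K * adjoint K)"
    then have il: "i < dA" "l < dA" using K by auto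
    have "(K * adjoint K) $$ (i,l) = (\<Sum>q<dB * N. C $$ (i * dB + q div N, q mod N) * cnj (C $$ (l * dB + q div N, q mod N)))"
      unfolding mult_adjoint_index[OF K K il] using il by (intro sum.cong refl) (simp add: K_def)
    also have "\<dots> = (\<Sum>j<dB. \<Sum>k<N. C $$ (i * dB + j, k) * cnj (C $$ (l * dB + j, k)))"
      by (rule sum_div_mod)
    also have "\<dots> = (\<Sum>j<dB. (C * adjoint C) $$ (i * dB + j, l * dB + j))"
      using il by (intro sum.cong refl mult_adjoint_index[OF C C, symmetric]) (auto intro: pair_index_less)
    finally show "ptrace_B dA dB (C * adjoint C) $$ (i,l) = (K * adjoint K) $$ (i,l)"
      using il by (simp add: ptrace_B_def)
  qed (use K in \<open>auto simp: ptrace_B_def\<close>)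
  then show ?thesis using psd_mult_adjoint[OF K] by simp
qed

text \<open>The B marginal does not see the basis chosen on A: summing over the columns of
  \<open>E\<close> inserts the completeness relation \<open>E E^* = 1\<close>. Hence the entropy
  term can be written in the product eigenbasis used for the divergences.\<close>

lemma ptrace_A_conj_diag:
  assumes E: "unitary E dA" and F: "unitary F dB" and M: "M \<in> carrier_mat (dA * dB) (dA * dB)" and j: "j < dB"
  shows "(adjoint F * ptrace_A dA dB M * F) $$ (j,j)
     = (\<Sum>i<dA. (adjoint (kron E F) * M * kron E F) $$ (i * dB + j, i * dB + j))"
proof -
  note Eu = unitaryD[OF E] and Fu = unitaryD[OF F]
  let ?N = "dA * dB"
  let ?V = "kron E F"
  have V: "?V \<in> carrier_mat ?N ?N" using Eu Fu by simp
  have P: "ptrace_A dA dB M \<in> carrier_mat dB dB" by (simp add: ptrace_A_def)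
  have quad: "(adjoint A * L * A) $$ (k,k) = (\<Sum>r<n. \<Sum>c<n. cnj (A $$ (r,k)) * L $$ (r,c) * A $$ (c,k))"
    if "A \<in> carrier_mat n n" "L \<in> carrier_mat n n" "k < n" for A L :: "complex mat" and n k
  proof -
    have "(adjoint A * L * A) $$ (k,k) = (adjoint A * (L * A)) $$ (k,k)"
      using that by (simp add: assoc_mult_mat[of _ n n _ n _ n])
    also have "\<dots> = (\<Sum>r<n. cnj (A $$ (r,k)) * (L * A) $$ (r,k))"
      using that by (intro adjoint_mult_index[of _ _ n _ n]) auto
    also have "\<dots> = (\<Sum>r<n. \<Sum>c<n. cnj (A $$ (r,k)) * L $$ (r,c) * A $$ (c,k))"
      using mult_index_sum[OF that(2,1) _ that(3)] by (simp add: sum_distrib_left mult.assoc)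
    finally show ?thesis .
  qed
  \<comment> \<open>The blocks of \<open>M\<close> over A, each sandwiched with column
    \<open>j\<close> of \<open>F\<close>; the A indices stay free for the completeness
    relation.\<close>
  define X where "X i i2 = (\<Sum>l<dB. \<Sum>l2<dB. cnj (F $$ (l,j)) * M $$ (i * dB + l, i2 * dB + l2) * F $$ (l2,j))" for i i2
  have entry: "(adjoint ?V * M * ?V) $$ (i * dB + j, i * dB + j) = (\<Sum>p<dA. \<Sum>p2<dA. E $$ (p2,i) * cnj (E $$ (p,i)) * X p p2)"
    if i: "i < dA" for i
  proof -
    let ?g = "\<lambda>p l p2 l2. cnj (E $$ (p,i) * F $$ (l,j)) * M $$ (p * dB + l, p2 * dB + l2) * (E $$ (p2,i) * F $$ (l2,j))"
    have ij: "i * dB + j < ?N" using i j by (rule pair_index_less)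
    have "(adjoint ?V * M * ?V) $$ (i * dB + j, i * dB + j) =
      (\<Sum>r<?N. \<Sum>c<?N. cnj (?V $$ (r,i * dB + j)) * M $$ (r,c) * ?V $$ (c,i * dB + j))"
      by (rule quad[OF V M ij])
    also have "\<dots> = (\<Sum>r<?N. \<Sum>c<?N. ?g (r div dB) (r mod dB) (c div dB) (c mod dB))"
      using j ij by (intro sum.cong refl) (simp add: kron_index[OF Eu(1) Fu(1)])
    also have "\<dots> = (\<Sum>r<?N. \<Sum>p2<dA. \<Sum>l2<dB. ?g (r div dB) (r mod dB) p2 l2)"
      by (intro sum.cong refl sum_div_mod)
    also have "\<dots> = (\<Sum>p<dA. \<Sum>l<dB. \<Sum>p2<dA. \<Sum>l2<dB. ?g p l p2 l2)"
      by (rule sum_div_mod)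
    also have "\<dots> = (\<Sum>p<dA. \<Sum>p2<dA. \<Sum>l<dB. \<Sum>l2<dB. ?g p l p2 l2)"
      by (rule sum.cong[OF refl], rule sum.swap)
    also have "\<dots> = (\<Sum>p<dA. \<Sum>p2<dA. E $$ (p2,i) * cnj (E $$ (p,i)) * X p p2)"
      unfolding X_def sum_distrib_left by (intro sum.cong refl) (simp add: mult_ac)
    finally show ?thesis .
  qed
  have "(\<Sum>i<dA. (adjoint ?V * M * ?V) $$ (i * dB + j, i * dB + j)) 
    = (\<Sum>i<dA. \<Sum>p<dA. \<Sum>p2<dA. E $$ (p2,i) * cnj (E $$ (p,i)) * X p p2)"
    using entry by (intro sum.cong) auto
  also have "\<dots> = (\<Sum>p<dA. \<Sum>i<dA. \<Sum>p2<dA. E $$ (p2,i) * cnj (E $$ (p,i)) * X p p2)"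
    by (rule sum.swap)
  also have "\<dots> = (\<Sum>p<dA. \<Sum>p2<dA. \<Sum>i<dA. E $$ (p2,i) * cnj (E $$ (p,i)) * X p p2)"
    by (rule sum.cong[OF refl], rule sum.swap)
  also have "\<dots> = (\<Sum>p<dA. \<Sum>p2<dA. (if p2 = p then 1 else 0) * X p p2)"
  proof (intro sum.cong refl)
    fix p p2 assume "p \<in> {..<dA}" "p2 \<in> {..<dA}"
    then have pp: "p2 < dA" "p < dA" by auto
    show "(\<Sum>i<dA. E $$ (p2,i) * cnj (E $$ (p,i)) * X p p2) = (if p2 = p then 1 else 0) * X p p2"
      using mult_adjoint_index[OF Eu(1) Eu(1) pp] Eu(3) pp by (simp add: sum_distrib_right[symmetric])
  qed
  also have "\<dots> = (\<Sum>p<dA. X p p)"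
    by (intro sum.cong refl) (simp add: if_distrib[of "\<lambda>x. x * _"] cong: if_cong)
  also have "\<dots> = (\<Sum>l<dB. \<Sum>l2<dB. \<Sum>p<dA. cnj (F $$ (l,j)) * M $$ (p * dB + l, p * dB + l2) * F $$ (l2,j))"
    unfolding X_def
    by (subst sum.swap, rule sum.cong[OF refl], rule sum.swap)
  also have "\<dots> = (adjoint F * ptrace_A dA dB M * F) $$ (j,j)"
    unfolding quad[OF Fu(1) P j]
    by (intro sum.cong refl) (simp add: ptrace_A_def sum_distrib_left sum_distrib_right)
  finally show ?thesis by simp
qed

text \<open>The array $w$ below is $w_{rk} = |\langle e_i \otimes f_j, C g_k \rangle|^2$ with $r = i \cdot d_B + j$.\<close>

locale product_frame =
  fixes dA dB :: nat and C E F :: "complex mat" and t s :: "nat \<Rightarrow> real" and \<alpha> \<beta> \<gamma> :: real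
  assumes C: "C \<in> carrier_mat (dA * dB) (dA * dB)"
    and E: "unitary E dA" and F: "unitary F dB"
    and t: "\<And>i. 0 \<le> t i" and s: "\<And>j. 0 \<le> s j" and sum_s: "(\<Sum>j<dB. s j) = 1"
    and pos: "\<alpha> > 0" "\<beta> > 0" "\<gamma> > 0"
    and ne1: "\<alpha> \<noteq> 1" "\<beta> \<noteq> 1" "\<gamma> \<noteq> 1"
    and conj_eq: "\<alpha> / (\<alpha> - 1) = \<beta> / (\<beta> - 1) + \<gamma> / (\<gamma> - 1)"
begin

definition "V = kron E F"
definition "A = adjoint V * C"
definition "T r = t (r div dB)"
definition "S r = s (r mod dB)"
definition "a = (\<alpha> - 1) / \<alpha>"
definition "b = (\<beta> - 1) / \<beta>"
definition "g = (\<gamma> - 1) / \<gamma>"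
text \<open>\<open>M1\<close> and \<open>M3\<close> carry the conditional and the joint divergence,
  whose reference operators have spectra \<open>T\<close> and \<open>T * S\<close>. The second place
  belongs to the marginal \<open>MB\<close>, matching the sums \<open>?G1\<close>,
  \<open>?G2\<close>, \<open>?G3\<close> below.\<close>

definition "M1 = adjoint C * unitary_diag V (\<lambda>r. T r powr (-a)) * C"
definition "M3 = adjoint C * unitary_diag V (\<lambda>r. (T r * S r) powr (-g)) * C"
definition "MB = ptrace_A dA dB (C * adjoint C)"
definition "w G = (\<lambda>(r,k). (cmod ((A * G) $$ (r,k)))\<^sup>2)"
abbreviation "N \<equiv> dA * dB"
abbreviation "I \<equiv> {..<N} \<times> {..<N}"

lemma V: "unitary V N" and Vc: "V \<in> carrier_mat N N"
  using kron_unitary[OF E F] unitaryD(1) by (auto simp: V_def)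

lemma Ac: "A \<in> carrier_mat N N"
  using Vc C by (simp add: A_def mult_carrier_mat[of _ N N])

lemma abg: "a \<noteq> 0" "b \<noteq> 0" "g \<noteq> 0" "1 / a = 1 / b + 1 / g"
  using pos ne1 conj_eq by (auto simp: a_def b_def g_def)

lemma sgn_abg: "0 < a \<longleftrightarrow> 1 < \<alpha>" "0 < b \<longleftrightarrow> 1 < \<beta>" "0 < g \<longleftrightarrow> 1 < \<gamma>"
  using pos by (auto simp: a_def b_def g_def zero_less_divide_iff)

lemma abg_prod: "a * b * g = (\<alpha> - 1) * (\<beta> - 1) * (\<gamma> - 1) / (\<alpha> * \<beta> * \<gamma>)"
  by (simp add: a_def b_def g_def)

lemma T: "0 \<le> T r" and S: "0 \<le> S r" using t s by (auto simp: T_def S_def)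

lemma w_nonneg: "0 \<le> w G x" by (simp add: w_def split: prod.split)

lemma psd_M1: "psd M1 N" and psd_M3: "psd M3 N" and psd_MB: "psd MB dB"
  using psd_conj[OF psd_unitary_diag[OF Vc] C] psd_ptrace_A[OF C] by (auto simp: M1_def M3_def MB_def)

lemma diag_entry:
  assumes G: "G \<in> carrier_mat N N" and k: "k < N"
  shows "Re ((adjoint G * (adjoint C * unitary_diag V d * C) * G) $$ (k,k)) = (\<Sum>r<N. w G (r,k) * d r)"
proof -
  have "adjoint G * (adjoint C * unitary_diag V d * C) * G = adjoint (C * G) * unitary_diag V d * (C * G)"
    using Vc C G by (intro conj_conj[of _ N _ N]) auto
  moreover have "adjoint V * (C * G) = A * G"
    using Vc C G by (simp add: A_def assoc_mult_mat[of _ N N _ N _ N])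
  ultimately show ?thesis
    using unitary_diag_quadratic[OF Vc, of "C * G" N k d] C G k by (simp add: w_def mult_carrier_mat[of _ N N])
qed

lemma M1_entry: "G \<in> carrier_mat N N \<Longrightarrow> k < N \<Longrightarrow>
    Re ((adjoint G * M1 * G) $$ (k,k)) = (\<Sum>r<N. w G (r,k) * T r powr (-a))"
  unfolding M1_def by (rule diag_entry)

lemma M3_entry: "G \<in> carrier_mat N N \<Longrightarrow> k < N \<Longrightarrow>
    Re ((adjoint G * M3 * G) $$ (k,k)) = (\<Sum>r<N. w G (r,k) * (T r * S r) powr (-g))"
  unfolding M3_def by (rule diag_entry)

text \<open>The unitary \<open>G\<close> cancels in \<open>(A G) (A G)^*\<close>, so the row sums of
  \<open>w G\<close> are the same for every \<open>G\<close>.\<close>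

lemma state_entry:
  assumes G: "unitary G N" and r: "r < N"
  shows "(adjoint V * (C * adjoint C) * V) $$ (r,r) = complex_of_real (\<Sum>k<N. w G (r,k))"
proof -
  note Gu = unitaryD[OF G]
  have aC: "adjoint C \<in> carrier_mat N N" using C by simp
  have AG: "A * G \<in> carrier_mat N N" using Ac Gu by simp
  have "adjoint A = adjoint C * V" using Vc C by (simp add: A_def adjoint_mult)
  then have "(A * G) * adjoint (A * G) = adjoint V * (C * adjoint C) * V"
    using Vc C aC Gu Ac unitary_cancel(2)[OF G, of "adjoint C * V" N]
    by (simp add: adjoint_mult[of A G] assoc_mult_mat[of _ N N _ N _ N] mult_carrier_mat[of _ N N _ N])
       (simp add: A_def assoc_mult_mat[of _ N N _ N _ N] mult_carrier_mat[of _ N N _ N])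
  then have "(adjoint V * (C * adjoint C) * V) $$ (r,r) = (\<Sum>k<N. (A * G) $$ (r,k) * cnj ((A * G) $$ (r,k)))"
    using mult_adjoint_index[OF AG AG r r] by simp
  also have "\<dots> = complex_of_real (\<Sum>k<N. w G (r,k))"
    by (simp add: w_def complex_norm_square del: of_real_power)
  finally show ?thesis .
qed

lemma MB_entry:
  assumes G: "unitary G N" and j: "j < dB"
  shows "Re ((adjoint F * MB * F) $$ (j,j)) = (\<Sum>i<dA. \<Sum>k<N. w G (i * dB + j, k))"
proof -
  have "C * adjoint C \<in> carrier_mat N N" using C by auto
  then have "(adjoint F * MB * F) $$ (j,j) = (\<Sum>i<dA. complex_of_real (\<Sum>k<N. w G (i * dB + j, k)))"
    unfolding MB_def using ptrace_A_conj_diag[OF E F _ j] state_entry[OF G] pair_index_less[OF _ j]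
    by (simp add: V_def[symmetric])
  then show ?thesis by simp
qed

text \<open>Row sums of the nonnegative \<open>w G\<close> do not depend on \<open>G\<close>, so
  zero rows can be read off at the identity. Support facts about \<open>A\<close> thus hold in any
  test basis.\<close>

lemma row_zero_iff:
  assumes G: "unitary G N" and r: "r < N"
  shows "(\<forall>k<N. w G (r,k) = 0) \<longleftrightarrow> (\<forall>k<N. A $$ (r,k) = 0)"
proof -
  have A1: "A * 1\<^sub>m N = A" using Ac by (simp add: right_mult_one_mat[of _ N N])
  have eq: "(\<Sum>k<N. w G (r,k)) = (\<Sum>k<N. w (1\<^sub>m N) (r,k))"
    using state_entry[OF G r] state_entry[OF unitary_one r] of_real_eq_iff by metis
  have "(\<forall>k<N. w G (r,k) = 0) \<longleftrightarrow> (\<Sum>k<N. w G (r,k)) = 0"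
    by (subst sum_nonneg_eq_0_iff) (auto simp: w_nonneg)
  also have "\<dots> \<longleftrightarrow> (\<forall>k<N. w (1\<^sub>m N) (r,k) = 0)"
    unfolding eq by (subst sum_nonneg_eq_0_iff) (auto simp: w_nonneg)
  also have "\<dots> \<longleftrightarrow> (\<forall>k<N. A $$ (r,k) = 0)" by (simp add: w_def A1)
  finally show ?thesis .
qed

lemma row_nonzero_obtain:
  assumes G: "unitary G N" and rk: "r < N" "k < N" "A $$ (r,k) \<noteq> 0"
  obtains k' where "k' < N" "0 < w G (r,k')"
  using row_zero_iff[OF G rk(1)] rk w_nonneg by (metis less_eq_real_def)

lemma sum_I1: 
  assumes "G \<in> carrier_mat N N"
  shows "(\<Sum>k<N. Re ((adjoint G * M1 * G) $$ (k,k)) * P k powr a)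
     = (\<Sum>x\<in>I. w G x * (T (fst x) powr (-a) * P (snd x) powr a))"
proof -
  have "(\<Sum>k<N. Re ((adjoint G * M1 * G) $$ (k,k)) * P k powr a)
     = (\<Sum>k<N. \<Sum>r<N. w G (r,k) * (T r powr (-a) * P k powr a))"
    by (intro sum.cong refl) (simp add: M1_entry[OF assms] sum_distrib_right mult.assoc)
  then show ?thesis by (subst (asm) sum.swap) (simp add: sum.cartesian_product case_prod_beta)
qed

lemma sum_I3: 
  assumes "G \<in> carrier_mat N N"
  shows "(\<Sum>k<N. Re ((adjoint G * M3 * G) $$ (k,k)) * P k powr g)
     = (\<Sum>x\<in>I. w G x * ((T (fst x) * S (fst x)) powr (-g) * P (snd x) powr g))"
proof -
  have "(\<Sum>k<N. Re ((adjoint G * M3 * G) $$ (k,k)) * P k powr g)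
     = (\<Sum>k<N. \<Sum>r<N. w G (r,k) * ((T r * S r) powr (-g) * P k powr g))"
    by (intro sum.cong refl) (simp add: M3_entry[OF assms] sum_distrib_right mult.assoc)
  then show ?thesis by (subst (asm) sum.swap) (simp add: sum.cartesian_product case_prod_beta)
qed

text \<open>\<open>MB_entry\<close> expresses each marginal entry as a sum of \<open>w\<close> over
  \<open>k\<close> and the A index, so the entropy term joins the common index set although it
  involves neither \<open>P\<close> nor \<open>T\<close>.\<close>

lemma sum_I2: 
  assumes G: "unitary G N"
  shows "(\<Sum>j<dB. Re ((adjoint F * MB * F) $$ (j,j)) * s j powr b) = (\<Sum>x\<in>I. w G x * S (fst x) powr b)"
proof -
  have "(\<Sum>j<dB. Re ((adjoint F * MB * F) $$ (j,j)) * s j powr b)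
     = (\<Sum>j<dB. \<Sum>i<dA. (\<Sum>k<N. w G (i * dB + j, k)) * s j powr b)"
    by (intro sum.cong refl) (simp add: MB_entry[OF G] sum_distrib_right)
  also have "\<dots> = (\<Sum>i<dA. \<Sum>j<dB. (\<Sum>k<N. w G (i * dB + j, k)) * s j powr b)"
    by (rule sum.swap)
  also have "\<dots> = (\<Sum>r<N. (\<Sum>k<N. w G (r div dB * dB + r mod dB, k)) * s (r mod dB) powr b)"
    by (rule sum_div_mod[symmetric])
  also have "\<dots> = (\<Sum>x\<in>I. w G x * S (fst x) powr b)"
    by (simp add: S_def sum_distrib_right sum.cartesian_product case_prod_beta)
  finally show ?thesis .
qed

lemma entry_zeroD:
  assumes "(\<Sum>r<N. w G (r,k) * f r) = 0" "\<And>r. 0 \<le> f r" "r < N"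
  shows "w G (r,k) = 0 \<or> f r = 0"
  using assms by (subst (asm) sum_nonneg_eq_0_iff) (auto simp: w_nonneg)

text \<open>\<open>G\<close> and \<open>P\<close> are optimal for \<open>M1\<close>, which makes the
  left side exact. They serve as trial data for \<open>M3\<close>, as do \<open>F\<close> and
  \<open>s\<close> for \<open>MB\<close>, and the variational bounds then point the right way for
  any \<open>s\<close>.\<close>

lemma product_pos:
  assumes prod: "(\<alpha> - 1) * (\<beta> - 1) * (\<gamma> - 1) > 0"
    and supp: "\<And>r k. \<gamma> > 1 \<Longrightarrow> r < N \<Longrightarrow> T r * S r = 0 \<Longrightarrow> k < N \<Longrightarrow> A $$ (r,k) = 0"
    and nz: "r0 < N" "k0 < N" "A $$ (r0,k0) \<noteq> 0" "T r0 * S r0 \<noteq> 0"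
  shows "ln (tr_power M1 \<alpha>) / (\<alpha> - 1) \<le> ln (tr_power M3 \<gamma>) / (\<gamma> - 1) + ln (tr_power MB \<beta>) / (\<beta> - 1)"
proof -
  have p: "a * b * g > 0" unfolding abg_prod using prod pos by auto
  have TS0: "T r0 > 0" "S r0 > 0" using nz(4) T[of r0] S[of r0] by auto
  have "tr_power M1 \<alpha> > 0"
  proof -
    obtain k where k: "k < N" "0 < w (1\<^sub>m N) (r0,k)" using row_nonzero_obtain[OF unitary_one nz(1-3)] .
    have "0 < (\<Sum>r<N. w (1\<^sub>m N) (r,k) * T r powr (-a))"
      by (rule sum_pos2[of _ r0]) (use nz k TS0 in \<open>auto simp: w_nonneg\<close>)
    also have "\<dots> = Re (M1 $$ (k,k))"
      using M1_entry[of "1\<^sub>m N" k] k psd_M1 unitaryD(2)[OF unitary_one, of N]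
      by (auto simp: psd_def hermitian_def right_mult_one_mat[of _ N N] left_mult_one_mat[of _ N N])
    finally show ?thesis using tr_power_pos[OF psd_M1 k(1)] by simp
  qed
  from tr_power_variational_attained[OF psd_M1 pos(1) ne1(1) this]
  obtain G P where G: "unitary G N" and P: "\<And>k. 0 \<le> P k" "(\<Sum>k<N. P k) = 1"
    and P0: "\<And>k. k < N \<Longrightarrow> P k = 0 \<longleftrightarrow> Re ((adjoint G * M1 * G) $$ (k,k)) = 0"
    and opt: "ln (\<Sum>k<N. Re ((adjoint G * M1 * G) $$ (k,k)) * P k powr a) / a = ln (tr_power M1 \<alpha>) / (\<alpha> - 1)"
    unfolding a_def by blast
  note Gc = unitaryD(1)[OF G]
  \<comment> \<open>An optimal weight vanishes only where the diagonal entry of \<open>M1\<close>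
    does, and then no positive \<open>w\<close> in that column meets a positive
    \<open>T\<close>.\<close>
  have wP: "0 < P k" if "r < N" "k < N" "0 < w G (r,k)" "0 < T r" for r k
  proof (rule ccontr)
    assume "\<not> ?thesis"
    then have "P k = 0" using P(1)[of k] by simp
    then have "(\<Sum>r<N. w G (r,k) * T r powr (-a)) = 0" using P0 M1_entry[OF Gc] that by simp
    from entry_zeroD[OF this _ that(1)] that show False by simp
  qed
  \<comment> \<open>For \<open>\<gamma> > 1\<close> the kernel inclusion empties all rows on which
    \<open>T * S\<close> vanishes.\<close>
  have wTS: "0 < T r \<and> 0 < S r" if "r < N" "k < N" "0 < w G (r,k)" "\<gamma> > 1" for r k
  proof -
    have "\<not> (\<forall>k<N. A $$ (r,k) = 0)" using row_zero_iff[OF G that(1)] that by auto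
    then have "T r * S r \<noteq> 0" using supp that by blast
    then show ?thesis using T[of r] S[of r] by auto
  qed
  obtain k1 where k1: "k1 < N" "0 < w G (r0,k1)" using row_nonzero_obtain[OF G nz(1-3)] .
  have P1: "P k1 > 0" using wP nz k1 TS0 by auto
  let ?G1 = "\<Sum>x\<in>I. w G x * (T (fst x) powr (-a) * P (snd x) powr a)"
  let ?G2 = "\<Sum>x\<in>I. w G x * S (fst x) powr b"
  let ?G3 = "\<Sum>x\<in>I. w G x * ((T (fst x) * S (fst x)) powr (-g) * P (snd x) powr g)"
  have gpos: "0 < ?G2" "0 < ?G3"
    by (rule sum_pos2[of _ "(r0,k1)"], use nz k1 TS0 P1 in \<open>auto simp: w_nonneg\<close>)+
  have "ln (tr_power M1 \<alpha>) / (\<alpha> - 1) = ln ?G1 / a"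
    using opt sum_I1[OF Gc] by simp
  also have "\<dots> \<le> ln ?G3 / g + ln ?G2 / b"
  proof (rule collinear_exponents_pos[where ?i0.0 = "(r0,k1)"])
    show "0 < T (fst x) \<and> 0 < S (fst x)" if "x \<in> I" "0 < w G x" "0 < g" for x
      using that wTS[of "fst x" "snd x"] sgn_abg by auto
    show "0 < P (snd x)" if "x \<in> I" "0 < w G x" "0 < T (fst x)" for x
      using that wP[of "fst x" "snd x"] by auto
  qed (use abg p T S P w_nonneg nz k1 TS0 in auto)
  also have "ln ?G3 / g \<le> ln (tr_power M3 \<gamma>) / (\<gamma> - 1)"
    unfolding sum_I3[OF Gc, symmetric] unfolding g_def
  proof (rule tr_power_variational[OF psd_M3 G pos(3) ne1(3)])
    show "Re ((adjoint G * M3 * G) $$ (k,k)) = 0" if "k < N" "P k = 0" for k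
    proof -
      have "(\<Sum>r<N. w G (r,k) * T r powr (-a)) = 0" using P0 M1_entry[OF Gc] that by simp
      \<comment> \<open>\<open>T r = 0\<close> makes the \<open>M3\<close> term 0 as well, again by
        \<open>0 powr p = 0\<close>.\<close>
      then have "w G (r,k) = 0 \<or> T r = 0" if "r < N" for r using entry_zeroD[of G k "\<lambda>r. T r powr (-a)" r] that by auto
      then show ?thesis unfolding M3_entry[OF Gc that(1)] by (intro sum.neutral) auto
    qed
    show "0 < (\<Sum>k<N. Re ((adjoint G * M3 * G) $$ (k,k)) * P k powr ((\<gamma> - 1) / \<gamma>))"
      using gpos(2) sum_I3[OF Gc] by (simp add: g_def)
  qed (use P in auto)
  also have "ln ?G2 / b \<le> ln (tr_power MB \<beta>) / (\<beta> - 1)"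
    unfolding sum_I2[OF G, symmetric] unfolding b_def
  proof (rule tr_power_variational[OF psd_MB F pos(2) ne1(2)])
    show "Re ((adjoint F * MB * F) $$ (j,j)) = 0" if j: "j < dB" "\<beta> < 1" "s j = 0" for j
    proof -
      \<comment> \<open>\<open>\<beta> < 1\<close> and \<open>\<gamma> < 1\<close> would give
        \<open>a > 0\<close> by the sign of the product, while \<open>1 / b + 1 / g\<close> is
        negative. So the kernel inclusion is at hand, and it empties the rows with
        \<open>s j = 0\<close>.\<close>
      have \<gamma>: "\<gamma> > 1"
      proof (rule ccontr)
        assume "\<not> ?thesis"
        then have "b < 0" "g < 0" using sgn_abg j ne1 abg by (auto simp: neq_iff)
        then have "a > 0" "1 / b < 0" "1 / g < 0" using p by (auto simp: zero_less_mult_iff mult_less_0_iff)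
        then show False using abg(4) by (smt (verit) divide_pos_pos)
      qed
      then have "w G (i * dB + j, k) = 0" if "i < dA" "k < N" for i k
      proof -
        have "\<not> 0 < w G (i * dB + j, k)"
          using wTS[of "i * dB + j" k] \<gamma> that j pair_index_less[of i dA j dB] by (auto simp: S_def)
        then show ?thesis using w_nonneg[of G "(i * dB + j, k)"] by linarith
      qed
      then show ?thesis unfolding MB_entry[OF G j(1)] by (intro sum.neutral ballI) auto
    qed
    show "0 < (\<Sum>k<dB. Re ((adjoint F * MB * F) $$ (k,k)) * s k powr ((\<beta> - 1) / \<beta>))"
      using gpos(1) sum_I2[OF G] by (simp add: b_def)
  qed (use s sum_s in auto)
  finally show ?thesis by simp
qed

text \<open>Now the two terms on the smaller side must be exact: \<open>G\<close>, \<open>P\<close>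
  are optimal for \<open>M3\<close> and, by \<open>optB\<close>, \<open>F\<close>, \<open>s\<close>
  for \<open>MB\<close>, while \<open>M1\<close> only receives trial data. The second conclusion
  serves to carry finiteness over to the joint divergence.\<close>

lemma product_neg:
  assumes prod: "(\<alpha> - 1) * (\<beta> - 1) * (\<gamma> - 1) < 0"
    and suppB: "\<And>j. j < dB \<Longrightarrow> s j = 0 \<Longrightarrow> Re ((adjoint F * MB * F) $$ (j,j)) = 0"
    and optB: "ln (\<Sum>j<dB. Re ((adjoint F * MB * F) $$ (j,j)) * s j powr ((\<beta> - 1) / \<beta>)) / ((\<beta> - 1) / \<beta>)
       = ln (tr_power MB \<beta>) / (\<beta> - 1)"
    and supp: "\<And>r k. \<alpha> > 1 \<Longrightarrow> r < N \<Longrightarrow> T r = 0 \<Longrightarrow> k < N \<Longrightarrow> A $$ (r,k) = 0"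
    and nz: "r0 < N" "k0 < N" "A $$ (r0,k0) \<noteq> 0" "T r0 \<noteq> 0"
  shows "ln (tr_power M3 \<gamma>) / (\<gamma> - 1) + ln (tr_power MB \<beta>) / (\<beta> - 1) \<le> ln (tr_power M1 \<alpha>) / (\<alpha> - 1)"
    and "\<And>r k. r < N \<Longrightarrow> S r = 0 \<Longrightarrow> k < N \<Longrightarrow> A $$ (r,k) = 0"
proof -
  have p: "a * b * g < 0" unfolding abg_prod using prod pos by (auto intro: divide_neg_pos)
  \<comment> \<open>Where \<open>s j = 0\<close> the diagonal entry of the marginal is 0; it is a
    sum of nonnegative \<open>w\<close>, so each of them vanishes.\<close>
  have wS: "0 < S r" if G: "unitary G N" and r: "r < N" "k < N" "0 < w G (r,k)" for G r k
  proof (rule ccontr)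
    assume "\<not> ?thesis"
    then have "S r = 0" using S[of r] by simp
    note rr = div_mod_less[OF r(1)]
    have "(\<Sum>i<dA. \<Sum>k<N. w G (i * dB + r mod dB, k)) = 0"
      using suppB[OF rr(2)] \<open>S r = 0\<close> MB_entry[OF G rr(2)] by (simp add: S_def)
    then have "(\<Sum>k<N. w G (r div dB * dB + r mod dB, k)) = 0"
      using rr(1) by (subst (asm) sum_nonneg_eq_0_iff) (blast intro: sum_nonneg w_nonneg)+
    then have "w G (r,k) = 0"
      using r(2) by (subst (asm) sum_nonneg_eq_0_iff) (auto intro!: w_nonneg)
    then show False using r by simp
  qed
  show "A $$ (r,k) = 0" if rk: "r < N" "S r = 0" "k < N" for r k
  proof (rule ccontr)
    assume nz: "A $$ (r,k) \<noteq> 0"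
    obtain k' where "k' < N" "0 < w (1\<^sub>m N) (r,k')" using row_nonzero_obtain[OF unitary_one rk(1,3) nz] .
    then show False using wS[OF unitary_one rk(1)] rk by auto
  qed
  have TS0: "T r0 > 0" "S r0 > 0"
  proof -
    show "T r0 > 0" using nz(4) T[of r0] by simp
    obtain k' where "k' < N" "0 < w (1\<^sub>m N) (r0,k')" using row_nonzero_obtain[OF unitary_one nz(1-3)] .
    then show "S r0 > 0" using wS[OF unitary_one nz(1)] by auto
  qed
  have "tr_power M3 \<gamma> > 0"
  proof -
    obtain k where k: "k < N" "0 < w (1\<^sub>m N) (r0,k)" using row_nonzero_obtain[OF unitary_one nz(1-3)] .
    have "0 < (\<Sum>r<N. w (1\<^sub>m N) (r,k) * (T r * S r) powr (-g))"
      by (rule sum_pos2[of _ r0]) (use nz k TS0 in \<open>auto simp: w_nonneg\<close>)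
    also have "\<dots> = Re (M3 $$ (k,k))"
      using M3_entry[of "1\<^sub>m N" k] k psd_M3 unitaryD(2)[OF unitary_one, of N]
      by (auto simp: psd_def hermitian_def right_mult_one_mat[of _ N N] left_mult_one_mat[of _ N N])
    finally show ?thesis using tr_power_pos[OF psd_M3 k(1)] by simp
  qed
  from tr_power_variational_attained[OF psd_M3 pos(3) ne1(3) this]
  obtain G P where G: "unitary G N" and P: "\<And>k. 0 \<le> P k" "(\<Sum>k<N. P k) = 1"
    and P0: "\<And>k. k < N \<Longrightarrow> P k = 0 \<longleftrightarrow> Re ((adjoint G * M3 * G) $$ (k,k)) = 0"
    and opt: "ln (\<Sum>k<N. Re ((adjoint G * M3 * G) $$ (k,k)) * P k powr g) / g = ln (tr_power M3 \<gamma>) / (\<gamma> - 1)"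
    unfolding g_def by blast
  note Gc = unitaryD(1)[OF G]
  \<comment> \<open>A zero weight kills the \<open>M3\<close> entry, and as \<open>S\<close> is
    positive wherever \<open>w\<close> is, only \<open>T\<close> can be responsible. This is the
    form needed for \<open>M1\<close>.\<close>
  have zeroP: "w G (r,k) = 0 \<or> T r = 0" if "r < N" "k < N" "P k = 0" for r k
  proof -
    have "(\<Sum>r<N. w G (r,k) * (T r * S r) powr (-g)) = 0" using P0 M3_entry[OF Gc] that by simp
    from entry_zeroD[OF this _ that(1)] have "w G (r,k) = 0 \<or> T r * S r = 0" by auto
    then show ?thesis using wS[OF G that(1,2)] w_nonneg[of G "(r,k)"] by force
  qed
  have wT: "0 < T r" if "r < N" "k < N" "0 < w G (r,k)" "\<alpha> > 1" for r k
  proof -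
    have "\<not> (\<forall>k<N. A $$ (r,k) = 0)" using row_zero_iff[OF G that(1)] that by auto
    then have "T r \<noteq> 0" using supp that by blast
    then show ?thesis using T[of r] by auto
  qed
  obtain k1 where k1: "k1 < N" "0 < w G (r0,k1)" using row_nonzero_obtain[OF G nz(1-3)] .
  have P1: "P k1 > 0" using zeroP[OF nz(1) k1(1)] nz k1 P(1)[of k1] by (auto simp: less_eq_real_def)
  let ?G1 = "\<Sum>x\<in>I. w G x * (T (fst x) powr (-a) * P (snd x) powr a)"
  let ?G2 = "\<Sum>x\<in>I. w G x * S (fst x) powr b"
  let ?G3 = "\<Sum>x\<in>I. w G x * ((T (fst x) * S (fst x)) powr (-g) * P (snd x) powr g)"
  have gpos: "0 < ?G1"
    by (rule sum_pos2[of _ "(r0,k1)"], use nz k1 TS0 P1 in \<open>auto simp: w_nonneg\<close>)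
  have "ln (tr_power M3 \<gamma>) / (\<gamma> - 1) + ln (tr_power MB \<beta>) / (\<beta> - 1) = ln ?G3 / g + ln ?G2 / b"
    by (simp only: opt[symmetric] optB[symmetric] b_def[symmetric] sum_I3[OF Gc] sum_I2[OF G])
  also have "\<dots> \<le> ln ?G1 / a"
  proof (rule collinear_exponents_neg[where ?i0.0 = "(r0,k1)"])
    show "0 < T (fst x)" if "x \<in> I" "0 < w G x" "0 < a" for x
      using that wT[of "fst x" "snd x"] sgn_abg by auto
    show "0 < S (fst x)" if "x \<in> I" "0 < w G x" for x
      using that wS[OF G, of "fst x" "snd x"] by auto
    show "0 < P (snd x)" if "x \<in> I" "0 < w G x" "0 < T (fst x)" for x
      using that zeroP[of "fst x" "snd x"] P(1)[of "snd x"] by (auto simp: less_eq_real_def)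
  qed (use abg p T S P w_nonneg nz k1 TS0 in auto)
  also have "ln ?G1 / a \<le> ln (tr_power M1 \<alpha>) / (\<alpha> - 1)"
    unfolding sum_I1[OF Gc, symmetric] unfolding a_def
  proof (rule tr_power_variational[OF psd_M1 G pos(1) ne1(1)])
    show "Re ((adjoint G * M1 * G) $$ (k,k)) = 0" if "k < N" "P k = 0" for k
      unfolding M1_entry[OF Gc that(1)] using zeroP that by (intro sum.neutral) auto
    show "0 < (\<Sum>k<N. Re ((adjoint G * M1 * G) $$ (k,k)) * P k powr ((\<alpha> - 1) / \<alpha>))"
      using gpos sum_I1[OF Gc] by (simp add: a_def)
  qed (use P in auto)
  finally show "ln (tr_power M3 \<gamma>) / (\<gamma> - 1) + ln (tr_power MB \<beta>) / (\<beta> - 1) \<le> ln (tr_power M1 \<alpha>) / (\<alpha> - 1)" .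
qed


section \<open>From power traces to divergences\<close>

abbreviation "state \<equiv> C * adjoint C"
abbreviation "cond_divergence \<equiv> sandwiched_renyi \<alpha> state (kron (unitary_diag E t) (1\<^sub>m dB))"
abbreviation "joint_divergence \<equiv> sandwiched_renyi \<gamma> state (kron (unitary_diag E t) (unitary_diag F s))"

lemma kron_one: "kron (unitary_diag E t) (1\<^sub>m dB) = unitary_diag V T"
  and kron_both: "kron (unitary_diag E t) (unitary_diag F s) = unitary_diag V (\<lambda>r. T r * S r)"
  using kron_unitary_diag_one[OF E F] kron_unitary_diag[OF E F] by (auto simp: V_def T_def[abs_def] S_def[abs_def])

lemma cond_divergence_eq:
  "renyi_finite \<alpha> state (unitary_diag V T) \<Longrightarrow> cond_divergence = ereal (ln (tr_power M1 \<alpha>) / (\<alpha> - 1) / ln 2)"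
  unfolding kron_one M1_def a_def by (rule sandwiched_renyi_unitary_diag[OF V C T pos(1)])

lemma joint_divergence_eq:
  "renyi_finite \<gamma> state (unitary_diag V (\<lambda>r. T r * S r)) \<Longrightarrow> joint_divergence = ereal (ln (tr_power M3 \<gamma>) / (\<gamma> - 1) / ln 2)"
  unfolding kron_both M3_def g_def
  by (rule sandwiched_renyi_unitary_diag[OF V C _ pos(3)]) (simp_all add: T S)

lemma entropy_eq: "renyi_entropy_B dA dB \<beta> state = - (ln (tr_power MB \<beta>) / (\<beta> - 1) / ln 2)"
proof -
  have "1 / (1 - \<beta>) = - (1 / (\<beta> - 1))" by (metis minus_diff_eq minus_divide_right)
  then show ?thesis by (simp add: renyi_entropy_B_def tr_power_def MB_def log_def)
qed

lemma dim_rho: "dim_row state = N" using C by simp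

text \<open>An infinite joint divergence makes the claim trivial. Otherwise its guard yields that of
  the conditional divergence, because \<open>T r * S r\<close> vanishes wherever \<open>T r\<close>
  does.\<close>

lemma product_pos_divergence:
  assumes prod: "(\<alpha> - 1) * (\<beta> - 1) * (\<gamma> - 1) > 0"
  shows "ereal (renyi_entropy_B dA dB \<beta> state) + cond_divergence \<le> joint_divergence"
proof (cases "renyi_finite \<gamma> state (unitary_diag V (\<lambda>r. T r * S r))")
  case False
  then show ?thesis by (simp add: kron_both sandwiched_renyi_infinite)
next
  case fin3: True
  obtain v where v: "v \<in> mimage state \<inter> mimage (unitary_diag V (\<lambda>r. T r * S r))" "v \<noteq> 0\<^sub>v N"
    using fin3 unfolding renyi_finite_def dim_rho by blast
  obtain r k where rk: "r < N" "k < N" "A $$ (r,k) \<noteq> 0" "T r * S r \<noteq> 0"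
    using common_image_entry[OF V C v] unfolding A_def by blast
  have ker: "A $$ (r,k) = 0" if "\<gamma> > 1" "r < N" "T r * S r = 0" "k < N" for r k
  proof -
    have "mkernel (unitary_diag V (\<lambda>r. T r * S r)) \<subseteq> mkernel state"
      using fin3 that(1) by (auto simp: renyi_finite_def)
    then show ?thesis unfolding mkernel_unitary_diag_subset[OF V C] A_def[symmetric] using that by blast
  qed
  have "renyi_finite \<alpha> state (unitary_diag V T)"
  proof -
    have "v \<in> mimage (unitary_diag V T)" using v unfolding mimage_unitary_diag[OF V] by auto
    moreover have "mkernel (unitary_diag V T) \<subseteq> mkernel state" if \<alpha>: "\<alpha> > 1"
    proof -
      \<comment> \<open>\<open>\<alpha> > 1\<close> with \<open>\<gamma> < 1\<close> would force
        \<open>b < 0\<close> by the sign of the product, against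
        \<open>1 / a = 1 / b + 1 / g\<close>. So the joint guard contains a kernel inclusion to pass
        on.\<close>
      have "\<gamma> > 1"
      proof (rule ccontr)
        assume "\<not> ?thesis"
        then have "g < 0" "a > 0" using sgn_abg \<alpha> abg by (auto simp: neq_iff)
        moreover have "a * b * g > 0" unfolding abg_prod using prod pos by auto
        ultimately have "b < 0" "1 / a > 0" "1 / g < 0" by (auto simp: zero_less_mult_iff mult_less_0_iff)
        then have "1 / b < 0" by simp
        then show False using abg(4) \<open>1 / a > 0\<close> \<open>1 / g < 0\<close> by linarith
      qed
      then show ?thesis unfolding mkernel_unitary_diag_subset[OF V C] A_def[symmetric] using ker by auto
    qed
    ultimately show ?thesis using v ne1 unfolding renyi_finite_def dim_rho by (metis IntD1 IntI linorder_neqE_linordered_idom)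
  qed
  note cond_eq = cond_divergence_eq[OF this]
  have "ln (tr_power M1 \<alpha>) / (\<alpha> - 1) / ln 2 \<le> (ln (tr_power M3 \<gamma>) / (\<gamma> - 1) + ln (tr_power MB \<beta>) / (\<beta> - 1)) / ln 2"
    using product_pos[OF prod ker rk] by (intro divide_right_mono) auto
  then show ?thesis unfolding cond_eq joint_divergence_eq[OF fin3] entropy_eq by (simp add: add_divide_distrib)
qed

text \<open>Finiteness has to pass from the conditional to the joint divergence, where zeros of
  \<open>S\<close> are additional zeros. They do no harm: \<open>s\<close> vanishes only where the B
  marginal does, so those rows of \<open>A\<close> are zero.\<close>

lemma product_neg_divergence:
  assumes prod: "(\<alpha> - 1) * (\<beta> - 1) * (\<gamma> - 1) < 0"
    and suppB: "\<And>j. j < dB \<Longrightarrow> s j = 0 \<Longrightarrow> Re ((adjoint F * MB * F) $$ (j,j)) = 0"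
    and optB: "ln (\<Sum>j<dB. Re ((adjoint F * MB * F) $$ (j,j)) * s j powr ((\<beta> - 1) / \<beta>)) / ((\<beta> - 1) / \<beta>)
       = ln (tr_power MB \<beta>) / (\<beta> - 1)"
  shows "joint_divergence \<le> ereal (renyi_entropy_B dA dB \<beta> state) + cond_divergence"
proof (cases "renyi_finite \<alpha> state (unitary_diag V T)")
  case False
  then show ?thesis by (simp add: kron_one sandwiched_renyi_infinite)
next
  case fin1: True
  obtain v where v: "v \<in> mimage state \<inter> mimage (unitary_diag V T)" "v \<noteq> 0\<^sub>v N"
    using fin1 unfolding renyi_finite_def dim_rho by blast
  obtain r k where rk: "r < N" "k < N" "A $$ (r,k) \<noteq> 0" "T r \<noteq> 0"
    using common_image_entry[OF V C v] unfolding A_def by blast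
  have ker: "A $$ (r,k) = 0" if "\<alpha> > 1" "r < N" "T r = 0" "k < N" for r k
  proof -
    have "mkernel (unitary_diag V T) \<subseteq> mkernel state"
      using fin1 that(1) by (auto simp: renyi_finite_def)
    then show ?thesis unfolding mkernel_unitary_diag_subset[OF V C] A_def[symmetric] using that by blast
  qed
  have rows: "A $$ (r,k) = 0" if "r < N" "S r = 0" "k < N" for r k
    by (rule product_neg(2)[OF prod _ optB _ rk]) (use suppB ker that in auto)
  have neg: "ln (tr_power M3 \<gamma>) / (\<gamma> - 1) + ln (tr_power MB \<beta>) / (\<beta> - 1) \<le> ln (tr_power M1 \<alpha>) / (\<alpha> - 1)"
    by (rule product_neg[OF prod _ optB _ rk]) (use suppB ker in auto)
  have "renyi_finite \<gamma> state (unitary_diag V (\<lambda>r. T r * S r))"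
  proof -
    obtain z where z: "\<And>r. r < N \<Longrightarrow> (adjoint V *\<^sub>v v) $ r = (\<Sum>k<N. A $$ (r,k) * z $ k)"
      using mimage_mult_adjoint[OF V C] v(1) unfolding A_def by blast
    have "(adjoint V *\<^sub>v v) $ r = 0" if "r < N" "S r = 0" for r
      using z[OF that(1)] rows[OF that] by simp
    then have "v \<in> mimage (unitary_diag V (\<lambda>r. T r * S r))" using v unfolding mimage_unitary_diag[OF V] by auto
    moreover have "mkernel (unitary_diag V (\<lambda>r. T r * S r)) \<subseteq> mkernel state" if \<gamma>: "\<gamma> > 1"
    proof -
      \<comment> \<open>\<open>g > 0\<close> and \<open>a < 0\<close> would force
        \<open>b > 0\<close> by the sign of the product, against the relation between the
        reciprocals.\<close>
      have "\<alpha> > 1"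
      proof (rule ccontr)
        assume "\<not> ?thesis"
        then have "g > 0" "a < 0" using sgn_abg \<gamma> abg by (auto simp: neq_iff)
        moreover have "a * b * g < 0" unfolding abg_prod using prod pos by (auto intro: divide_neg_pos)
        ultimately have "b > 0" "1 / a < 0" "1 / g > 0" by (auto simp: zero_less_mult_iff mult_less_0_iff)
        then have "1 / b > 0" by simp
        then show False using abg(4) \<open>1 / a < 0\<close> \<open>1 / g > 0\<close> by linarith
      qed
      then show ?thesis unfolding mkernel_unitary_diag_subset[OF V C] A_def[symmetric] using ker rows by auto
    qed
    ultimately show ?thesis using v ne1 unfolding renyi_finite_def dim_rho by (metis IntD1 IntI linorder_neqE_linordered_idom)
  qed
  note joint_eq = joint_divergence_eq[OF this]
  have "(ln (tr_power M3 \<gamma>) / (\<gamma> - 1) + ln (tr_power MB \<beta>) / (\<beta> - 1)) / ln 2 \<le> ln (tr_power M1 \<alpha>) / (\<alpha> - 1) / ln 2"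
    using neg by (intro divide_right_mono) auto
  then show ?thesis unfolding joint_eq cond_divergence_eq[OF fin1] entropy_eq by (simp add: add_divide_distrib)
qed

end

section \<open>Infima over the marginal states\<close>

lemma densityE:
  assumes "density \<sigma> n"
  obtains U d where "unitary U n" "\<And>i. 0 \<le> d i" "(\<Sum>i<n. d i) = 1" "\<sigma> = unitary_diag U d"
proof -
  obtain U d where U: "unitary U n" "\<And>i. 0 \<le> d i" "\<sigma> = unitary_diag U d"
    using assms psd_unitary_diagE[of \<sigma> n] by (auto simp: density_def)
  have "complex_of_real (\<Sum>i<n. d i) = 1" using mtrace_unitary_diag[OF U(1), of d] U(3) assms by (simp add: density_def)
  then have "(\<Sum>i<n. d i) = 1" using of_real_eq_1_iff by blast
  then show thesis using U that by blast
qed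

lemma density_unitary_diag:
  assumes "unitary U n" "\<And>i. 0 \<le> d i" "(\<Sum>i<n. d i) = 1"
  shows "density (unitary_diag U d) n"
  using assms mtrace_unitary_diag[OF assms(1), of d] psd_unitary_diag[OF unitaryD(1)[OF assms(1)], of d]
  by (simp add: density_def)

theorem theorem1:
  fixes dA dB :: nat and \<rho> :: "complex mat" and \<alpha> \<beta> \<gamma> :: real
  assumes "density \<rho> (dA * dB)"
    and "\<alpha> > 0" and "\<beta> \<ge> 1/2" and "\<gamma> \<ge> 1/2"
    and "\<alpha> \<noteq> 1" and "\<beta> \<noteq> 1" and "\<gamma> \<noteq> 1"
    and "\<alpha> / (\<alpha> - 1) = \<beta> / (\<beta> - 1) + \<gamma> / (\<gamma> - 1)"
  shows "((\<alpha> - 1) * (\<beta> - 1) * (\<gamma> - 1) > 0 \<longrightarrow>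
            mutual_info_up dA dB \<gamma> \<rho> \<ge> ereal (renyi_entropy_B dA dB \<beta> \<rho>) - cond_entropy_down dA dB \<alpha> \<rho> \<and>
            mutual_info_down dA dB \<gamma> \<rho> \<ge> ereal (renyi_entropy_B dA dB \<beta> \<rho>) - cond_entropy_up dA dB \<alpha> \<rho>)
       \<and> ((\<alpha> - 1) * (\<beta> - 1) * (\<gamma> - 1) < 0 \<longrightarrow>
            mutual_info_up dA dB \<gamma> \<rho> \<le> ereal (renyi_entropy_B dA dB \<beta> \<rho>) - cond_entropy_down dA dB \<alpha> \<rho> \<and>
            mutual_info_down dA dB \<gamma> \<rho> \<le> ereal (renyi_entropy_B dA dB \<beta> \<rho>) - cond_entropy_up dA dB \<alpha> \<rho>)"
proof -
  obtain U d where U: "unitary U (dA * dB)" "\<And>i. 0 \<le> d i" "\<rho> = unitary_diag U d"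
    using densityE[OF assms(1)] by blast
  obtain C where CC: "C \<in> carrier_mat (dA * dB) (dA * dB)" "\<rho> = C * adjoint C"
    using unitary_diag_eq_mult_adjoint[OF unitaryD(1)[OF U(1)], of d] U(2,3) by blast
  define h where "h = ereal (renyi_entropy_B dA dB \<beta> \<rho>)"
  have h: "\<bar>h\<bar> \<noteq> \<infinity>" by (simp add: h_def)
  define Dc where "Dc \<tau> = sandwiched_renyi \<alpha> \<rho> (kron \<tau> (1\<^sub>m dB))" for \<tau>
  define Dj where "Dj \<tau> \<sigma> = sandwiched_renyi \<gamma> \<rho> (kron \<tau> \<sigma>)" for \<tau> \<sigma>
  have down: "h - cond_entropy_down dA dB \<alpha> \<rho> = h + Dc (ptrace_B dA dB \<rho>)"
    by (simp add: cond_entropy_down_def Dc_def minus_ereal_def)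
  have up: "h - cond_entropy_up dA dB \<alpha> \<rho> = h + (INF \<tau>\<in>{\<tau>. density \<tau> dA}. Dc \<tau>)"
    by (simp add: cond_entropy_up_def Dc_def minus_ereal_def)
  have Iup: "mutual_info_up dA dB \<gamma> \<rho> = (INF \<sigma>\<in>{\<sigma>. density \<sigma> dB}. Dj (ptrace_B dA dB \<rho>) \<sigma>)"
    by (simp add: mutual_info_up_def Dj_def)
  have Idown: "mutual_info_down dA dB \<gamma> \<rho> = (INF x\<in>{\<tau>. density \<tau> dA} \<times> {\<sigma>. density \<sigma> dB}. Dj (fst x) (snd x))"
    by (simp add: mutual_info_down_def Dj_def)
  have tr: "mtrace \<rho> = 1" and \<rho>: "\<rho> \<in> carrier_mat (dA * dB) (dA * dB)"
    using assms(1) by (auto simp: density_def psd_def hermitian_def)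
  have dens_A: "density (ptrace_B dA dB \<rho>) dA"
    using psd_ptrace_B[OF CC(1)] CC(2) mtrace_ptrace_B[OF \<rho>] tr by (simp add: density_def)
  have dens_B: "density (ptrace_A dA dB \<rho>) dB"
    using psd_ptrace_A[OF CC(1)] CC(2) mtrace_ptrace_A[OF \<rho>] tr by (simp add: density_def)
  have frame: "product_frame dA dB C E F t s \<alpha> \<beta> \<gamma>"
    if "unitary E dA" "unitary F dB" "\<And>i. 0 \<le> t i" "\<And>i. 0 \<le> s i" "(\<Sum>j<dB. s j) = 1" for E F t s
    using that assms CC by unfold_locales auto
  have "mutual_info_up dA dB \<gamma> \<rho> \<ge> h + Dc (ptrace_B dA dB \<rho>)"
    "mutual_info_down dA dB \<gamma> \<rho> \<ge> h + (INF \<tau>\<in>{\<tau>. density \<tau> dA}. Dc \<tau>)"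
    if prod: "(\<alpha> - 1) * (\<beta> - 1) * (\<gamma> - 1) > 0"
  proof -
    \<comment> \<open>One estimate for arbitrary \<open>\<tau>\<close> and \<open>\<sigma>\<close>
      serves both claims: the first fixes \<open>\<tau>\<close> as the A marginal, the second lets
      both vary.\<close>
    have key: "h + Dc \<tau> \<le> Dj \<tau> \<sigma>" if \<tau>: "density \<tau> dA" and \<sigma>: "density \<sigma> dB" for \<tau> \<sigma>
    proof -
      obtain E t where Et: "unitary E dA" "\<And>i. 0 \<le> t i" "\<tau> = unitary_diag E t" using densityE[OF \<tau>] by metis
      obtain F s where Fs: "unitary F dB" "\<And>i. 0 \<le> s i" "(\<Sum>j<dB. s j) = 1" "\<sigma> = unitary_diag F s"
        using densityE[OF \<sigma>] by metis
      interpret product_frame dA dB C E F t s \<alpha> \<beta> \<gamma> by (rule frame[OF Et(1) Fs(1) Et(2) Fs(2,3)])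
      show ?thesis using product_pos_divergence[OF prod] CC(2) Et Fs by (simp add: h_def Dc_def Dj_def)
    qed
    show "mutual_info_up dA dB \<gamma> \<rho> \<ge> h + Dc (ptrace_B dA dB \<rho>)"
      unfolding Iup using key[OF dens_A] by (intro INF_greatest) auto
    show "mutual_info_down dA dB \<gamma> \<rho> \<ge> h + (INF \<tau>\<in>{\<tau>. density \<tau> dA}. Dc \<tau>)"
      unfolding Idown
    proof (intro INF_greatest)
      fix x assume "x \<in> {\<tau>. density \<tau> dA} \<times> {\<sigma>. density \<sigma> dB}"
      then have x: "density (fst x) dA" "density (snd x) dB" by auto
      have "h + (INF \<tau>\<in>{\<tau>. density \<tau> dA}. Dc \<tau>) \<le> h + Dc (fst x)"
        using x by (intro add_left_mono INF_lower) auto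
      also have "\<dots> \<le> Dj (fst x) (snd x)" by (rule key[OF x])
      finally show "h + (INF \<tau>\<in>{\<tau>. density \<tau> dA}. Dc \<tau>) \<le> Dj (fst x) (snd x)" .
    qed
  qed
  moreover have "mutual_info_up dA dB \<gamma> \<rho> \<le> h + Dc (ptrace_B dA dB \<rho>)"
    "mutual_info_down dA dB \<gamma> \<rho> \<le> h + (INF \<tau>\<in>{\<tau>. density \<tau> dA}. Dc \<tau>)"
    if prod: "(\<alpha> - 1) * (\<beta> - 1) * (\<gamma> - 1) < 0"
  proof -
    have psd_B: "psd (ptrace_A dA dB \<rho>) dB" using dens_B by (simp add: density_def)
    have \<beta>: "\<beta> > 0" using assms(3) by linarith
    have "tr_power (ptrace_A dA dB \<rho>) \<beta> > 0"
    proof -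
      have "\<exists>j<dB. Re (ptrace_A dA dB \<rho> $$ (j,j)) \<noteq> 0"
      proof (rule ccontr)
        assume "\<not> ?thesis"
        then have "Re (mtrace (ptrace_A dA dB \<rho>)) = 0" by (simp add: mtrace_def ptrace_A_def)
        then show False using dens_B by (simp add: density_def)
      qed
      then obtain j where "j < dB" "Re (ptrace_A dA dB \<rho> $$ (j,j)) > 0"
        using psd_diag_entry[OF psd_B] by (metis less_eq_real_def)
      then show ?thesis by (rule tr_power_pos[OF psd_B])
    qed
    \<comment> \<open>\<open>F\<close> and \<open>s\<close> depend on the B marginal and
      \<open>\<beta>\<close> alone, so a single \<open>\<sigma>\<close> works for every
      \<open>\<tau>\<close> below.\<close>
    from tr_power_variational_attained[OF psd_B \<beta> assms(6) this]
    obtain F s where Fs: "unitary F dB" "\<And>j. 0 \<le> s j" "(\<Sum>j<dB. s j) = 1"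
      and supp: "\<And>j. j < dB \<Longrightarrow> s j = 0 \<longleftrightarrow> Re ((adjoint F * ptrace_A dA dB \<rho> * F) $$ (j,j)) = 0"
      and opt: "ln (\<Sum>j<dB. Re ((adjoint F * ptrace_A dA dB \<rho> * F) $$ (j,j)) * s j powr ((\<beta> - 1) / \<beta>)) / ((\<beta> - 1) / \<beta>)
         = ln (tr_power (ptrace_A dA dB \<rho>) \<beta>) / (\<beta> - 1)"
      by blast
    define \<sigma> where "\<sigma> = unitary_diag F s"
    have \<sigma>: "density \<sigma> dB" unfolding \<sigma>_def by (rule density_unitary_diag[OF Fs])
    have key: "Dj \<tau> \<sigma> \<le> h + Dc \<tau>" if \<tau>: "density \<tau> dA" for \<tau>
    proof -
      obtain E t where Et: "unitary E dA" "\<And>i. 0 \<le> t i" "\<tau> = unitary_diag E t" using densityE[OF \<tau>] by metis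
      interpret product_frame dA dB C E F t s \<alpha> \<beta> \<gamma> by (rule frame[OF Et(1) Fs(1) Et(2) Fs(2,3)])
      have MB: "MB = ptrace_A dA dB \<rho>" by (simp add: MB_def CC(2))
      show ?thesis using product_neg_divergence[OF prod] supp opt Et CC(2)
        unfolding MB by (simp add: h_def Dc_def Dj_def \<sigma>_def)
    qed
    show "mutual_info_up dA dB \<gamma> \<rho> \<le> h + Dc (ptrace_B dA dB \<rho>)"
      unfolding Iup using key[OF dens_A] \<sigma> by (intro INF_lower2[of \<sigma>]) auto
    \<comment> \<open>The finite \<open>h\<close> is moved to the left so that the infimum stands
      alone and can be bounded below termwise.\<close>
    have "mutual_info_down dA dB \<gamma> \<rho> - h \<le> (INF \<tau>\<in>{\<tau>. density \<tau> dA}. Dc \<tau>)"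
    proof (intro INF_greatest)
      fix \<tau> assume "\<tau> \<in> {\<tau>. density \<tau> dA}"
      then have \<tau>: "density \<tau> dA" by simp
      have "mutual_info_down dA dB \<gamma> \<rho> \<le> Dj \<tau> \<sigma>"
        unfolding Idown using \<tau> \<sigma> by (intro INF_lower2[of "(\<tau>,\<sigma>)"]) auto
      also have "\<dots> \<le> Dc \<tau> + h" using key[OF \<tau>] by (simp add: add.commute)
      finally show "mutual_info_down dA dB \<gamma> \<rho> - h \<le> Dc \<tau>" using h by (simp add: ereal_minus_le)
    qed
    then show "mutual_info_down dA dB \<gamma> \<rho> \<le> h + (INF \<tau>\<in>{\<tau>. density \<tau> dA}. Dc \<tau>)"
      using h by (simp add: ereal_minus_le add.commute)
  qed
  ultimately show ?thesis unfolding h_def[symmetric] down up by blast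
qed

end
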